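(* For every positive integer $v\notin\{2,6,8\}$ there exists a PBD$(v,\{3,4,5\})$ in which any three points generate a flat of size at most $63$, unless $v-[e]_4\in\{1,3,9\}$ for some integer $e\ge 3$, in which case there exists a PBD$(v,\{3,4,5\})$ in which any three points generate a flat of size at most $94$.
   Context: A PBD$(v,K)$ is a pair $(X,\mathcal{B})$ with $|X|=v$ and $\mathcal{B}$ a family of subsets (blocks) of $X$ with sizes in $K$, such that every pair of distinct points lies in exactly one block. A flat is a subset $Y\subseteq X$ such that any two distinct points of $Y$ lie in a block contained in $Y$; the flat generated by a set $S$ is the intersection of all flats containing $S$. For an integer $e\ge0$, $[e]_4=1+4+4^2+\cdots+4^e$. *)

theory Defs
  imports Main
begin

definition is_PBD :: "nat \<Rightarrow> nat set \<Rightarrow> 'a set \<Rightarrow> 'a set set \<Rightarrow> bool" where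
  "is_PBD v K X \<B> \<longleftrightarrow>
     finite X \<and> card X = v \<and>
     (\<forall>B\<in>\<B>. B \<subseteq> X \<and> card B \<in> K) \<and>
     (\<forall>x\<in>X. \<forall>y\<in>X. x \<noteq> y \<longrightarrow> (\<exists>!B. B \<in> \<B> \<and> x \<in> B \<and> y \<in> B))"

definition is_flat :: "'a set \<Rightarrow> 'a set set \<Rightarrow> 'a set \<Rightarrow> bool" where
  "is_flat X \<B> Y \<longleftrightarrow>
     Y \<subseteq> X \<and>
     (\<forall>x\<in>Y. \<forall>y\<in>Y. x \<noteq> y \<longrightarrow> (\<exists>B\<in>\<B>. x \<in> B \<and> y \<in> B \<and> B \<subseteq> Y))"

(* In a PBD the whole point set is a flat, so for S \<subseteq> X the intersection is
   over a nonempty family and stays inside X. *)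
definition flat_generated :: "'a set \<Rightarrow> 'a set set \<Rightarrow> 'a set \<Rightarrow> 'a set" where
  "flat_generated X \<B> S = \<Inter> {Y. is_flat X \<B> Y \<and> S \<subseteq> Y}"

definition three_point_flats_le :: "nat \<Rightarrow> 'a set \<Rightarrow> 'a set set \<Rightarrow> bool" where
  "three_point_flats_le m X \<B> \<longleftrightarrow>
     (\<forall>S. S \<subseteq> X \<and> card S = 3 \<longrightarrow> card (flat_generated X \<B> S) \<le> m)"

definition bracket4 :: "nat \<Rightarrow> nat" where
  "bracket4 e = (\<Sum>i=0..e. 4 ^ i)"

end

theory Submission
  imports Defs "HOL-Computational_Algebra.Polynomial"
begin

text \<open>Give the points of PG(n,4) weights 0, 1 or 3 and replace every line by a group divisible
  design with block sizes 3, 4, 5 whose groups have the weights as sizes. Planes then give flats of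
  size at most 3 * 21 = 63. Without points of weight 0 every line is replaceable, which yields all
  odd v from [n] to 3[n]; with one point of weight 0 one gets the even v from [n] - 1 to 3[n] - 3
  except [n] + 1, [n] + 3, [n] + 9. For v = 4^n + s with s < [n-1] - 1, put weight 1 on the affine
  points and a weighting of total s on the hyperplane at infinity; if s is itself exceptional,
  and also for v = 4^n - 2, v is instead the size of the complement of a set without trisecants, built from affine pieces.

  For v = [n+1] + d with d = 1, 3, 9, use weight 4 on PG(n,4), except for one line of total weight
  22, 24 or 30; a plane through that line has weight 84 + 2, 84 + 4 or 84 + 10.\<close>

section \<open>Projective space over GF(4)\<close>

text \<open>The constants come from the lines through a point of weight 0. Among the other four
  points of such a line, exactly one or exactly two cannot have weight 3 while the rest have weight
  1: a design there, with its groups as further blocks, would be a PBD on 6 or 8 points with block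
  sizes 3, 4, 5. So every such line carries 0, 3 or 4 points of weight 3, and their number u is a
  sum of threes and fours. Only 1, 2 and 5 are not such sums; as the total weight is [n] - 1 + 2u,
  this costs the values [n] + 1, [n] + 3, [n] + 9.

  The orders 2, 6, 8 open the same family as [0] + 1, [1] + 1, [1] + 3. Its next members do no harm:
  14 = 4^2 - 2, and 22, 24, 30 are at most 63, so the bound on flats is automatic. Hence the larger
  bound starts at e = 3.

  In a fixed dimension 3[n] - 1 is out of reach as well: lowering a weight from 3 to 1 or 0 costs 2
  or 3, never 1. The value equals 4^(n+1) - 2 and is obtained one dimension higher.\<close>

datatype gf4 = Zero | One | Om | Om2

instantiation gf4 :: field
begin

definition "zero_gf4 = Zero"
definition "one_gf4 = One"

text \<open>\<open>Om\<close> is a primitive cube root of unity and \<open>Om2\<close> is its square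
  \<open>Om + 1\<close>. With full tables, \<open>cases\<close> and \<open>simp\<close> decide the
  field laws and later the finite checks in the plane.\<close>

fun plus_gf4 :: "gf4 \<Rightarrow> gf4 \<Rightarrow> gf4" where
  "plus_gf4 Zero y = y"
| "plus_gf4 x Zero = x"
| "plus_gf4 One One = Zero"
| "plus_gf4 One Om = Om2"
| "plus_gf4 One Om2 = Om"
| "plus_gf4 Om One = Om2"
| "plus_gf4 Om Om = Zero"
| "plus_gf4 Om Om2 = One"
| "plus_gf4 Om2 One = Om"
| "plus_gf4 Om2 Om = One"
| "plus_gf4 Om2 Om2 = Zero"

fun times_gf4 :: "gf4 \<Rightarrow> gf4 \<Rightarrow> gf4" where
  "times_gf4 Zero y = Zero"
| "times_gf4 x Zero = Zero"
| "times_gf4 One y = y"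
| "times_gf4 x One = x"
| "times_gf4 Om Om = Om2"
| "times_gf4 Om Om2 = One"
| "times_gf4 Om2 Om = One"
| "times_gf4 Om2 Om2 = Om"

fun inverse_gf4 :: "gf4 \<Rightarrow> gf4" where
  "inverse_gf4 Zero = Zero"
| "inverse_gf4 One = One"
| "inverse_gf4 Om = Om2"
| "inverse_gf4 Om2 = Om"

definition "uminus_gf4 (x :: gf4) = x"
definition "minus_gf4 (x :: gf4) y = x + y"
definition "divide_gf4 (x :: gf4) y = x * inverse y"

instance
proof
  fix a b c :: gf4
  show "a + b + c = a + (b + c)" by (cases a; cases b; cases c) simp_all
  show "a + b = b + a" by (cases a; cases b) simp_all
  show "0 + a = a" by (simp add: zero_gf4_def)
  show "- a + a = 0" by (cases a) (simp_all add: zero_gf4_def uminus_gf4_def)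
  show "a - b = a + - b" by (simp add: minus_gf4_def uminus_gf4_def)
  show "a * b * c = a * (b * c)" by (cases a; cases b; cases c) simp_all
  show "a * b = b * a" by (cases a; cases b) simp_all
  show "1 * a = a" by (cases a) (simp_all add: one_gf4_def)
  show "(a + b) * c = a * c + b * c" by (cases a; cases b; cases c) simp_all
  show "(0::gf4) \<noteq> 1" by (simp add: zero_gf4_def one_gf4_def)
  show "a \<noteq> 0 \<Longrightarrow> inverse a * a = 1" by (cases a) (simp_all add: zero_gf4_def one_gf4_def)
  show "a div b = a * inverse b" by (simp add: divide_gf4_def)
  show "inverse (0::gf4) = 0" by (simp add: zero_gf4_def)
qed

end

lemma UNIV_gf4: "(UNIV :: gf4 set) = {Zero, One, Om, Om2}"
  by (auto intro: gf4.exhaust)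

instance gf4 :: finite
  by standard (simp add: UNIV_gf4)

lemma card_gf4: "card (UNIV :: gf4 set) = 4"
  by (simp add: UNIV_gf4)

text \<open>Points are normalised by their leading coefficient instead of being classes of nonzero vectors.\<close>

definition PG :: "nat \<Rightarrow> gf4 poly set" where
  "PG n = {p. lead_coeff p = 1 \<and> degree p \<le> n}"

text \<open>Meant for \<open>degree z < degree x\<close>: a combination of \<open>x\<close> and
  \<open>z\<close> with nonzero coefficient at \<open>x\<close> then has the degree of
  \<open>x\<close> and normalises to some \<open>x + smult a z\<close>, so no rescaling
  enters.\<close>

definition pline :: "gf4 poly \<Rightarrow> gf4 poly \<Rightarrow> gf4 poly set" where
  "pline x z = insert z (range (\<lambda>a. x + smult a z))"

definition lines :: "nat \<Rightarrow> gf4 poly set set" where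
  "lines n = {pline x z | x z. x \<in> PG n \<and> z \<in> PG n \<and> degree z < degree x}"

definition monic_assoc :: "gf4 poly \<Rightarrow> gf4 poly" where
  "monic_assoc p = smult (inverse (lead_coeff p)) p"

section \<open>Points and their number\<close>

lemma PG_nonzero: "p \<in> PG n \<Longrightarrow> p \<noteq> 0"
  by (auto simp: PG_def)

lemma PG_0: "PG 0 = {1}"
  by (auto simp: PG_def elim!: degree_eq_zeroE)

text \<open>Forgetting the constant coefficient is the projection from the point \<open>1\<close>;
  the fibre over \<open>r\<close> consists of the four points other than \<open>1\<close> on one
  line through \<open>1\<close>.\<close>

lemma PG_Suc: "PG (Suc n) = insert 1 ((\<lambda>(a, r). pCons a r) ` (UNIV \<times> PG n))"
proof
  show "PG (Suc n) \<subseteq> insert 1 ((\<lambda>(a, r). pCons a r) ` (UNIV \<times> PG n))"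
  proof
    fix p assume p: "p \<in> PG (Suc n)"
    obtain a r where pr: "p = pCons a r" by (cases p) auto
    show "p \<in> insert 1 ((\<lambda>(a, r). pCons a r) ` (UNIV \<times> PG n))"
    proof (cases "r = 0")
      case True
      then show ?thesis using p pr by (auto simp: PG_def)
    next
      case False
      then have "r \<in> PG n" using p pr by (auto simp: PG_def)
      then show ?thesis using pr by auto
    qed
  qed
qed (auto simp: PG_def)

lemma finite_PG: "finite (PG n)"
  by (induction n) (auto simp: PG_0 PG_Suc)

lemma bracket4_0 [simp]: "bracket4 0 = 1"
  by (simp add: bracket4_def)

lemma bracket4_Suc: "bracket4 (Suc n) = bracket4 n + 4 ^ Suc n"
  by (simp add: bracket4_def)

lemma three_bracket4: "3 * bracket4 n + 1 = 4 ^ Suc n"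
  by (induction n) (auto simp: bracket4_Suc)

lemma bracket4_Suc': "bracket4 (Suc n) = 4 * bracket4 n + 1"
  using three_bracket4[of n] by (simp add: bracket4_Suc)

lemma card_PG: "card (PG n) = bracket4 n"
proof (induction n)
  case 0
  then show ?case by (simp add: PG_0)
next
  case (Suc n)
  have inj: "inj_on (\<lambda>(a, r). pCons a r) (UNIV \<times> PG n)"
    by (auto simp: inj_on_def)
  have "1 \<notin> (\<lambda>(a::gf4, r). pCons a r) ` (UNIV \<times> PG n)"
    using PG_nonzero[of 0 n] by (auto simp: one_pCons)
  then have "card (PG (Suc n)) = Suc (card ((\<lambda>(a::gf4, r). pCons a r) ` (UNIV \<times> PG n)))"
    unfolding PG_Suc by (intro card_insert_disjoint finite_imageI finite_cartesian_product finite_PG finite)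
  also have "\<dots> = 4 * bracket4 n + 1"
    by (simp only: card_image[OF inj] card_cartesian_product card_gf4 Suc)
  finally show ?case by (simp add: bracket4_Suc')
qed

lemma PG_mono: "m \<le> n \<Longrightarrow> PG m \<subseteq> PG n"
  by (auto simp: PG_def)

lemma affine_point_monic:
  assumes "x \<in> PG n" "degree z < degree x"
  shows "x + smult a z \<in> PG n" "degree (x + smult a z) = degree x"
proof -
  have d: "degree (smult a z) < degree x"
    using assms(2) degree_smult_le[of a z] by linarith
  then show "degree (x + smult a z) = degree x" by (rule degree_add_eq_left)
  then show "x + smult a z \<in> PG n"
    using assms d by (auto simp: PG_def coeff_eq_0)
qed

section \<open>Lines and the line through two points\<close>

lemma pline_subset: "x \<in> PG n \<Longrightarrow> z \<in> PG n \<Longrightarrow> degree z < degree x \<Longrightarrow> pline x z \<subseteq> PG n"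
  unfolding pline_def using affine_point_monic by blast

lemma inj_affine: "(z :: gf4 poly) \<noteq> 0 \<Longrightarrow> inj (\<lambda>a. x + smult a z)"
proof (rule injI)
  fix a b assume z: "z \<noteq> 0" and "x + smult a z = x + smult b z"
  then have "smult (a - b) z = 0" by (simp add: smult_diff_left)
  then show "a = b" using z by simp
qed

lemma direction_not_affine:
  "x \<in> PG n \<Longrightarrow> degree z < degree x \<Longrightarrow> z \<notin> range (\<lambda>a. x + smult a z)"
  using affine_point_monic(2) by (metis (no_types, lifting) imageE less_irrefl)

lemma card_pline:
  assumes "x \<in> PG n" "z \<in> PG n" "degree z < degree x"
  shows "card (pline x z) = 5"
  unfolding pline_def using direction_not_affine[OF assms(1,3)] PG_nonzero[OF assms(2)]
  by (simp add: card_image inj_affine card_gf4)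

lemma monic_assoc_PG: "p \<noteq> 0 \<Longrightarrow> degree p \<le> n \<Longrightarrow> monic_assoc p \<in> PG n"
  by (auto simp: monic_assoc_def PG_def)

lemma monic_assoc_smult: "z \<in> PG n \<Longrightarrow> a \<noteq> 0 \<Longrightarrow> monic_assoc (smult a z) = z"
  by (simp add: monic_assoc_def PG_def)

lemma smult_monic_assoc: "p \<noteq> 0 \<Longrightarrow> smult (lead_coeff p) (monic_assoc p) = p"
  by (simp add: monic_assoc_def)

lemma pline_shift: "pline (x + smult a z) z = pline x z"
proof -
  have "range (\<lambda>b. x + smult a z + smult b z) = range (\<lambda>b. x + smult b z)"
  proof (intro subset_antisym subsetI)
    fix y assume "y \<in> range (\<lambda>b. x + smult b z)"
    then obtain b where "y = x + smult b z" by blast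
    then have "y = x + smult a z + smult (b - a) z" by (simp add: smult_diff_left)
    then show "y \<in> range (\<lambda>b. x + smult a z + smult b z)" by blast
  qed (auto simp: add.assoc smult_add_left[symmetric])
  then show ?thesis by (simp add: pline_def)
qed

lemma degree_monic_diff:
  assumes "p \<in> PG n" "q \<in> PG n" "degree p = degree q" "p \<noteq> q"
  shows "degree (p - q) < degree p"
proof -
  have le: "degree (p - q) \<le> degree p" using assms(3) by (simp add: degree_diff_le)
  moreover have "coeff (p - q) (degree p) = 0" using assms by (simp add: PG_def)
  ultimately show ?thesis using assms(4) by (metis eq_iff_diff_eq_0 leading_coeff_0_iff le_neq_implies_less)
qed

text \<open>Each line has one point of minimal degree, the direction of its four other points.\<close>

definition line_through :: "gf4 poly \<Rightarrow> gf4 poly \<Rightarrow> gf4 poly set" where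
  "line_through p q = (if degree p = degree q then pline p (monic_assoc (p - q))
     else if degree q < degree p then pline p q else pline q p)"

text \<open>Two points of different degree include the direction, namely the one of lower degree.
  Two of equal degree are both affine, and their difference is a nonzero multiple of the
  direction.\<close>

lemma line_through_unique:
  assumes "x \<in> PG n" "z \<in> PG n" "degree z < degree x" "p \<in> pline x z" "q \<in> pline x z" "p \<noteq> q"
  shows "pline x z = line_through p q"
proof -
  note deg = affine_point_monic(2)[OF assms(1,3)]
  consider "p = z" "q \<noteq> z" | "q = z" "p \<noteq> z" | "p \<noteq> z" "q \<noteq> z" using assms(6) by blast
  then show ?thesis
  proof cases
    case 1
    then obtain a where a: "q = x + smult a z" using assms(5) by (auto simp: pline_def)
    have "degree p < degree q" using 1(1) a deg[of a] assms(3) by simp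
    then have "line_through p q = pline q z" using 1(1) by (simp add: line_through_def)
    then show ?thesis by (simp add: a pline_shift)
  next
    case 2
    then obtain a where a: "p = x + smult a z" using assms(4) by (auto simp: pline_def)
    have "degree q < degree p" using 2(1) a deg[of a] assms(3) by simp
    then have "line_through p q = pline p z" using 2(1) by (simp add: line_through_def)
    then show ?thesis by (simp add: a pline_shift)
  next
    case 3
    then obtain a b where ab: "p = x + smult a z" "q = x + smult b z"
      using assms(4,5) by (auto simp: pline_def)
    then have "p - q = smult (a - b) z" "a - b \<noteq> 0" using assms(6) by (auto simp: smult_diff_left)
    then have "monic_assoc (p - q) = z" using monic_assoc_smult[OF assms(2)] by metis
    moreover have "degree p = degree q" unfolding ab deg ..
    ultimately have "line_through p q = pline p z" by (simp add: line_through_def)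
    then show ?thesis by (simp add: ab pline_shift)
  qed
qed

lemma line_through:
  assumes "p \<in> PG n" "q \<in> PG n" "p \<noteq> q"
  shows "line_through p q \<in> lines n" "p \<in> line_through p q" "q \<in> line_through p q"
proof -
  have self: "x \<in> pline x z" for x z :: "gf4 poly"
    unfolding pline_def by (intro insertI2 range_eqI[of _ _ 0]) simp
  have dir: "z \<in> pline x z" for x z by (simp add: pline_def)
  have "line_through p q \<in> lines n \<and> p \<in> line_through p q \<and> q \<in> line_through p q"
  proof (cases "degree p = degree q")
    case True
    let ?z = "monic_assoc (p - q)"
    have d: "degree (p - q) < degree p" using degree_monic_diff[OF assms(1,2) True assms(3)] .
    have nz: "p - q \<noteq> 0" using assms(3) by simp
    have z: "?z \<in> PG n" using d assms(1) by (intro monic_assoc_PG[OF nz]) (simp add: PG_def)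
    have dz: "degree ?z < degree p" using d nz by (simp add: monic_assoc_def)
    have "p + smult (- lead_coeff (p - q)) ?z = p - (p - q)"
      using smult_monic_assoc[OF nz] by (simp only: smult_minus_left diff_conv_add_uminus)
    then have "q = p + smult (- lead_coeff (p - q)) ?z" by simp
    then have "q \<in> pline p ?z" unfolding pline_def by (intro insertI2 range_eqI)
    moreover have "pline p ?z \<in> lines n" unfolding lines_def using z dz assms(1) by blast
    ultimately show ?thesis using True self by (simp add: line_through_def)
  next
    case False
    then consider "degree q < degree p" | "degree p < degree q" by linarith
    then show ?thesis
    proof cases
      case 1
      then have "pline p q \<in> lines n" unfolding lines_def using assms by blast
      then show ?thesis using 1 self dir by (simp add: line_through_def)
    next
      case 2
      then have "pline q p \<in> lines n" unfolding lines_def using assms by blast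
      then show ?thesis using 2 self dir by (simp add: line_through_def)
    qed
  qed
  then show "line_through p q \<in> lines n" "p \<in> line_through p q" "q \<in> line_through p q" by auto
qed

lemma ex1_line:
  assumes "p \<in> PG n" "q \<in> PG n" "p \<noteq> q"
  shows "\<exists>!l. l \<in> lines n \<and> p \<in> l \<and> q \<in> l"
proof (rule ex1I[of _ "line_through p q"])
  show "line_through p q \<in> lines n \<and> p \<in> line_through p q \<and> q \<in> line_through p q"
    using line_through[OF assms] by auto
qed (use line_through_unique assms(3) in \<open>auto simp: lines_def\<close>)

lemma line_subset: "l \<in> lines n \<Longrightarrow> l \<subseteq> PG n"
  using pline_subset by (auto simp: lines_def)

lemma card_line: "l \<in> lines n \<Longrightarrow> card l = 5"
  using card_pline by (auto simp: lines_def)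

text \<open>Take the normalised vectors in the span of \<open>p\<close>, \<open>q\<close>,
  \<open>r\<close>. Their nonzero multiples, three for each point, are distinct nonzero vectors
  among at most 4^3 - 1 = 63, whence 21. The points may be collinear or equal, so \<open>F\<close>
  may be smaller than a plane.\<close>

lemma plane_exists:
  assumes "p \<in> PG n" "q \<in> PG n" "r \<in> PG n"
  shows "\<exists>F. F \<subseteq> PG n \<and> p \<in> F \<and> q \<in> F \<and> r \<in> F \<and> card F \<le> 21 \<and>
    (\<forall>l\<in>lines n. \<forall>x\<in>l \<inter> F. \<forall>y\<in>l \<inter> F. x \<noteq> y \<longrightarrow> l \<subseteq> F)"
proof -
  define h where "h a b c = smult a p + smult b q + smult c r" for a b c
  define g where "g = (\<lambda>(a, b, c). h a b c)"
  have range_g: "x \<in> range g \<longleftrightarrow> (\<exists>a b c. x = h a b c)" for x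
    by (simp add: g_def image_iff)
  define F where "F = PG n \<inter> range g"
  have "h 1 0 0 = p" "h 0 1 0 = q" "h 0 0 1 = r" by (simp_all add: h_def)
  then have mem: "p \<in> F" "q \<in> F" "r \<in> F"
    using assms unfolding F_def range_g Int_iff by blast+
  have h_comb: "smult a (h a1 b1 c1) + smult b (h a2 b2 c2)
      = h (a * a1 + b * a2) (a * b1 + b * b2) (a * c1 + b * c2)" for a b a1 b1 c1 a2 b2 c2
    by (simp add: h_def smult_add_left smult_add_right add_ac)
  have comb: "smult a x + smult b y \<in> range g" if xy: "x \<in> range g" "y \<in> range g" for a b x y
  proof -
    obtain a1 b1 c1 where "x = h a1 b1 c1"
      using xy(1) unfolding range_g by blast
    moreover obtain a2 b2 c2 where "y = h a2 b2 c2"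
      using xy(2) unfolding range_g by blast
    ultimately show ?thesis unfolding range_g using h_comb by (intro exI) simp
  qed
  have inj0: "c = d \<and> x = y" if h: "c \<noteq> 0" "d \<noteq> 0" "x \<in> F" "y \<in> F" "smult c x = smult d y" for c d x y
  proof -
    have "monic_assoc (smult c x) = x" "monic_assoc (smult d y) = y"
      using h monic_assoc_smult unfolding F_def by blast+
    then have xy: "x = y" using h(5) by simp
    have "lead_coeff x = 1" using h(3) by (simp add: F_def PG_def)
    moreover have "lead_coeff (smult c x) = lead_coeff (smult d x)" using h(5) xy by simp
    ultimately show ?thesis using xy by (simp only: lead_coeff_smult mult_1_right)
  qed
  have inj: "inj_on (\<lambda>(c, f). smult c f) ((UNIV - {0}) \<times> F)"
  proof (rule inj_onI)
    fix s t assume st: "s \<in> (UNIV - {0}) \<times> F" "t \<in> (UNIV - {0}) \<times> F"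
      "(case s of (c, f) \<Rightarrow> smult c f) = (case t of (c, f) \<Rightarrow> smult c f)"
    obtain c x where s: "s = (c, x)" by (cases s)
    obtain d y where t: "t = (d, y)" by (cases t)
    show "s = t" using inj0[of c d x y] st by (simp add: s t)
  qed
  have img: "smult c f \<in> range g - {0}" if "c \<noteq> 0" "f \<in> F" for c f
    using that comb[of f f c 0] PG_nonzero by (auto simp: F_def)
  have "(\<lambda>(c, f). smult c f) ` ((UNIV - {0}) \<times> F) \<subseteq> range g - {0}"
  proof (rule image_subsetI)
    fix s assume "s \<in> (UNIV - {0 :: gf4}) \<times> F"
    then have "fst s \<noteq> 0" "snd s \<in> F" by (simp_all add: mem_Times_iff)
    then show "(case s of (c, f) \<Rightarrow> smult c f) \<in> range g - {0}"
      unfolding split_beta by (rule img)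
  qed
  then have "card ((UNIV - {0 :: gf4}) \<times> F) \<le> card (range g - {0})"
    unfolding card_image[OF inj, symmetric] by (intro card_mono) simp_all
  also have "\<dots> = card (range g) - 1"
  proof -
    have "0 = h 0 0 0" by (simp add: h_def)
    then have "0 \<in> range g" unfolding range_g by (intro exI)
    then show ?thesis by simp
  qed
  also have "card (range g) \<le> 64"
    using card_image_le[of "UNIV :: (gf4 \<times> gf4 \<times> gf4) set" g]
    by (simp add: card_gf4 UNIV_Times_UNIV[symmetric] card_cartesian_product del: UNIV_Times_UNIV)
  finally have "card F \<le> 21"
    by (simp add: card_cartesian_product card_Diff_singleton card_gf4)
  moreover have "l \<subseteq> F" if l: "l \<in> lines n" "x \<in> l \<inter> F" "y \<in> l \<inter> F" "x \<noteq> y" for l x y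
  proof -
    obtain u z where uz: "u \<in> PG n" "z \<in> PG n" "degree z < degree u" "l = pline u z"
      using l(1) by (auto simp: lines_def)
    have lt: "l = line_through x y"
      using line_through_unique[OF uz(1-3)] l uz(4) by auto
    have diff: "monic_assoc (x - y) \<in> range g"
      using comb[of x y "inverse (lead_coeff (x - y))" "- inverse (lead_coeff (x - y))"] l
      by (simp add: monic_assoc_def smult_diff_right F_def)
    have pline: "pline s t \<subseteq> range g" if "s \<in> range g" "t \<in> range g" for s t
      using that comb[of s t 1] by (auto simp: pline_def)
    have "l \<subseteq> range g" unfolding lt line_through_def using pline diff l by (auto simp: F_def)
    then show ?thesis using line_subset[OF l(1)] by (auto simp: F_def)
  qed
  ultimately show ?thesis using mem by (intro exI[of _ F]) (auto simp: F_def)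
qed

section \<open>Replacing the lines of a weighted linear space\<close>

definition fib :: "('p \<Rightarrow> nat) \<Rightarrow> 'p set \<Rightarrow> ('p \<times> nat) set" where
  "fib w S = Sigma S (\<lambda>x. {..<w x})"

text \<open>The groups are the fibres of \<open>fst\<close>. Injectivity of \<open>fst\<close> on a
  block says that the block is transversal, so no block covers a pair inside a group; a point of
  weight 0 is just an empty group.\<close>

definition is_gdd :: "('p \<Rightarrow> nat) \<Rightarrow> 'p set \<Rightarrow> ('p \<times> nat) set set \<Rightarrow> bool" where
  "is_gdd w l G \<longleftrightarrow>
     (\<forall>B\<in>G. B \<subseteq> fib w l \<and> card B \<in> {3, 4, 5} \<and> inj_on fst B) \<and>
     (\<forall>p\<in>fib w l. \<forall>q\<in>fib w l. fst p \<noteq> fst q \<longrightarrow> (\<exists>!B. B \<in> G \<and> p \<in> B \<and> q \<in> B))"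

lemma ex1_same: "\<exists>!x. Q x \<Longrightarrow> Q a \<Longrightarrow> Q b \<Longrightarrow> a = b"
  by blast

lemma is_gdd_ex1:
  "is_gdd w l G \<Longrightarrow> p \<in> fib w l \<Longrightarrow> q \<in> fib w l \<Longrightarrow> fst p \<noteq> fst q \<Longrightarrow>
    \<exists>!B. B \<in> G \<and> p \<in> B \<and> q \<in> B"
  by (simp add: is_gdd_def)

lemma is_gdd_block:
  assumes "is_gdd w l G" "B \<in> G"
  shows "B \<subseteq> fib w l" "card B \<in> {3, 4, 5}" "inj_on fst B"
  using assms by (auto simp only: is_gdd_def)

lemma is_PBD_ex1:
  "is_PBD v K X \<B> \<Longrightarrow> x \<in> X \<Longrightarrow> y \<in> X \<Longrightarrow> x \<noteq> y \<Longrightarrow> \<exists>!B. B \<in> \<B> \<and> x \<in> B \<and> y \<in> B"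
  by (simp add: is_PBD_def)

lemma is_PBD_block:
  assumes "is_PBD v K X \<B>" "B \<in> \<B>"
  shows "B \<subseteq> X" "card B \<in> K"
  using assms by (auto simp only: is_PBD_def)

lemma fst_in_fib: "C \<subseteq> fib w S \<Longrightarrow> p \<in> C \<Longrightarrow> fst p \<in> S"
  by (auto simp: fib_def)

lemma card_fib: "finite P \<Longrightarrow> card (fib w P) = (\<Sum>x\<in>P. w x)"
  unfolding fib_def by (subst card_SigmaI) auto

lemma finite_fib: "finite P \<Longrightarrow> finite (fib w P)"
  unfolding fib_def by auto

lemma fib_mono: "S \<subseteq> T \<Longrightarrow> fib w S \<subseteq> fib w T"
  unfolding fib_def by auto

text \<open>Wilson's fundamental construction on a linear space: each line is inflated to a group
  divisible design, and each inflated point is filled with a small PBD.\<close>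

locale weighted_linear_space =
  fixes P :: "'p set" and Ls :: "'p set set" and w :: "'p \<Rightarrow> nat"
    and G :: "'p set \<Rightarrow> ('p \<times> nat) set set" and H :: "'p \<Rightarrow> ('p \<times> nat) set set"
  assumes finite_P: "finite P"
    and line_sub: "l \<in> Ls \<Longrightarrow> l \<subseteq> P"
    and line_ex1: "x \<in> P \<Longrightarrow> y \<in> P \<Longrightarrow> x \<noteq> y \<Longrightarrow> \<exists>!l. l \<in> Ls \<and> x \<in> l \<and> y \<in> l"
    and gdd: "l \<in> Ls \<Longrightarrow> is_gdd w l (G l)"
    and fill: "x \<in> P \<Longrightarrow> is_PBD (w x) {3, 4, 5} (fib w {x}) (H x)"
begin

definition blocks :: "('p \<times> nat) set set" where
  "blocks = \<Union> (G ` Ls) \<union> \<Union> (H ` P)"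

text \<open>A filling block stays over one point, and a block over another line would make that line
  share two points with \<open>l\<close>. So only the design on \<open>l\<close> can cover the
  pair.\<close>

lemma block_between_fibres:
  assumes p: "p \<in> fib w P" "q \<in> fib w P" "fst p \<noteq> fst q"
    and l: "l \<in> Ls" "fst p \<in> l" "fst q \<in> l"
  shows "\<exists>!B. B \<in> blocks \<and> p \<in> B \<and> q \<in> B" "\<exists>B\<in>G l. p \<in> B \<and> q \<in> B"
proof -
  have pq: "p \<in> fib w l" "q \<in> fib w l" using p l by (auto simp: fib_def)
  note ex1 = is_gdd_ex1[OF gdd[OF l(1)] pq p(3)]
  from ex1 obtain B where B: "B \<in> G l" "p \<in> B" "q \<in> B" by (elim ex1E conjE)
  show "\<exists>B\<in>G l. p \<in> B \<and> q \<in> B" using B by blast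
  show "\<exists>!B. B \<in> blocks \<and> p \<in> B \<and> q \<in> B"
  proof (rule ex1I[of _ B])
    show "B \<in> blocks \<and> p \<in> B \<and> q \<in> B" using B l by (auto simp: blocks_def)
    fix C assume C: "C \<in> blocks \<and> p \<in> C \<and> q \<in> C"
    have "C \<notin> H z" if "z \<in> P" for z
    proof
      assume "C \<in> H z"
      then have "C \<subseteq> fib w {z}" using is_PBD_block(1)[OF fill[OF that]] by blast
      then show False using C p(3) fst_in_fib[of C w "{z}"] by simp
    qed
    then obtain k where k: "k \<in> Ls" "C \<in> G k" using C by (auto simp: blocks_def)
    then have "C \<subseteq> fib w k" using is_gdd_block(1)[OF gdd[OF k(1)]] by blast
    then have "fst p \<in> k" "fst q \<in> k" using C fst_in_fib by blast+
    moreover have "fst p \<in> P" "fst q \<in> P" using p by (auto simp: fib_def)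
    ultimately have "k = l" using ex1_same[OF line_ex1[of "fst p" "fst q"]] l k(1) p(3) by blast
    then show "C = B" using ex1_same[OF ex1, of C B] B C k(2) by blast
  qed
qed

lemma block_in_fibre:
  assumes p: "p \<in> fib w P" "q \<in> fib w P" "fst p = fst q" "p \<noteq> q"
  shows "\<exists>!B. B \<in> blocks \<and> p \<in> B \<and> q \<in> B" "\<exists>B\<in>H (fst p). p \<in> B \<and> q \<in> B"
proof -
  have x: "fst p \<in> P" using p by (auto simp: fib_def)
  have pq: "p \<in> fib w {fst p}" "q \<in> fib w {fst p}" using p by (auto simp: fib_def)
  note ex1 = is_PBD_ex1[OF fill[OF x] pq p(4)]
  from ex1 obtain B where B: "B \<in> H (fst p)" "p \<in> B" "q \<in> B" by (elim ex1E conjE)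
  then show "\<exists>B\<in>H (fst p). p \<in> B \<and> q \<in> B" by blast
  show "\<exists>!B. B \<in> blocks \<and> p \<in> B \<and> q \<in> B"
  proof (rule ex1I[of _ B])
    show "B \<in> blocks \<and> p \<in> B \<and> q \<in> B" using B x by (auto simp: blocks_def)
    fix C assume C: "C \<in> blocks \<and> p \<in> C \<and> q \<in> C"
    have "C \<notin> G k" if "k \<in> Ls" for k
    proof
      assume "C \<in> G k"
      then have "inj_on fst C" using is_gdd_block(3)[OF gdd[OF that]] by blast
      then show False using C p(3,4) by (auto dest: inj_onD)
    qed
    then obtain z where z: "z \<in> P" "C \<in> H z" using C by (auto simp: blocks_def)
    then have "C \<subseteq> fib w {z}" using is_PBD_block(1)[OF fill[OF z(1)]] by blast
    then have "z = fst p" using C fst_in_fib[of C w "{z}" p] by simp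
    then show "C = B" using ex1_same[OF ex1, of C B] B C z(2) by blast
  qed
qed

lemma blocks_PBD: "is_PBD (\<Sum>x\<in>P. w x) {3, 4, 5} (fib w P) blocks"
  unfolding is_PBD_def
proof (intro conjI ballI impI)
  show "finite (fib w P)" "card (fib w P) = (\<Sum>x\<in>P. w x)"
    using finite_P by (simp_all add: finite_fib card_fib)
  fix B assume B: "B \<in> blocks"
  show "B \<subseteq> fib w P"
  proof (cases "\<exists>l\<in>Ls. B \<in> G l")
    case True
    then obtain l where l: "l \<in> Ls" "B \<in> G l" by blast
    then have "B \<subseteq> fib w l" using is_gdd_block(1)[OF gdd] by blast
    then show ?thesis using fib_mono[OF line_sub[OF l(1)]] by blast
  next
    case False
    then obtain x where x: "x \<in> P" "B \<in> H x" using B by (auto simp: blocks_def)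
    then have "B \<subseteq> fib w {x}" using is_PBD_block(1)[OF fill] by blast
    then show ?thesis using fib_mono[of "{x}" P w] x(1) by blast
  qed
  show "card B \<in> {3, 4, 5}"
    using B is_gdd_block(2)[OF gdd] is_PBD_block(2)[OF fill] unfolding blocks_def by blast
next
  fix p q assume pq: "p \<in> fib w P" "q \<in> fib w P" "p \<noteq> q"
  show "\<exists>!B. B \<in> blocks \<and> p \<in> B \<and> q \<in> B"
  proof (cases "fst p = fst q")
    case True
    then show ?thesis using block_in_fibre(1) pq by blast
  next
    case False
    then obtain l where "l \<in> Ls" "fst p \<in> l" "fst q \<in> l"
      using line_ex1[of "fst p" "fst q"] fst_in_fib[OF subset_refl pq(1)]
        fst_in_fib[OF subset_refl pq(2)] by blast
    then show ?thesis using block_between_fibres(1)[OF pq(1,2) False] by blast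
  qed
qed

text \<open>The block through two points lies over a single point or over a line, and both stay
  inside a set closed under lines. This is how planes control the flats generated by three
  points.\<close>

lemma fib_flat:
  assumes F: "F \<subseteq> P" "\<And>l x y. l \<in> Ls \<Longrightarrow> x \<in> l \<inter> F \<Longrightarrow> y \<in> l \<inter> F \<Longrightarrow> x \<noteq> y \<Longrightarrow> l \<subseteq> F"
  shows "is_flat (fib w P) blocks (fib w F)"
  unfolding is_flat_def
proof (intro conjI ballI impI)
  show "fib w F \<subseteq> fib w P" using F(1) by (rule fib_mono)
  fix p q assume pq: "p \<in> fib w F" "q \<in> fib w F" "p \<noteq> q"
  have x: "fst p \<in> F" "fst q \<in> F" using pq by (auto simp: fib_def)
  have pq': "p \<in> fib w P" "q \<in> fib w P" using pq fib_mono[OF F(1)] by blast+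
  show "\<exists>B\<in>blocks. p \<in> B \<and> q \<in> B \<and> B \<subseteq> fib w F"
  proof (cases "fst p = fst q")
    case True
    then obtain B where B: "B \<in> H (fst p)" "p \<in> B" "q \<in> B"
      using block_in_fibre(2) pq' pq(3) by blast
    have "B \<subseteq> fib w {fst p}" using is_PBD_block(1)[OF fill[of "fst p"]] x F(1) B(1) by blast
    then have "B \<subseteq> fib w F" using fib_mono[of "{fst p}" F w] x by blast
    moreover have "B \<in> blocks" using B x F(1) by (auto simp: blocks_def)
    ultimately show ?thesis using B by blast
  next
    case False
    then obtain l where l: "l \<in> Ls" "fst p \<in> l" "fst q \<in> l"
      using line_ex1[of "fst p" "fst q"] x F(1) by blast
    then obtain B where B: "B \<in> G l" "p \<in> B" "q \<in> B"
      using block_between_fibres(2) pq' False by blast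
    have "l \<subseteq> F" using F(2)[of l "fst p" "fst q"] l x False by blast
    moreover have "B \<subseteq> fib w l" using is_gdd_block(1)[OF gdd[OF l(1)] B(1)] .
    ultimately have "B \<subseteq> fib w F" using fib_mono by blast
    moreover have "B \<in> blocks" using B l(1) by (auto simp: blocks_def)
    ultimately show ?thesis using B by blast
  qed
qed

end

section \<open>Moving designs to other point sets\<close>

lemma is_PBD_image:
  assumes inj: "inj_on h X" and PBD: "is_PBD v K X \<B>"
  shows "is_PBD v K (h ` X) ((`) h ` \<B>)"
  unfolding is_PBD_def
proof (intro conjI ballI impI)
  have sub: "B \<subseteq> X" if "B \<in> \<B>" for B using PBD that by (auto simp: is_PBD_def)
  show "finite (h ` X)" using PBD by (simp add: is_PBD_def)
  show "card (h ` X) = v" using PBD by (simp add: is_PBD_def card_image[OF inj])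
  fix C assume "C \<in> (`) h ` \<B>"
  then obtain B where B: "B \<in> \<B>" "C = h ` B" by blast
  then show "C \<subseteq> h ` X" "card C \<in> K"
    using PBD sub card_image[OF inj_on_subset[OF inj sub[OF B(1)]]]
    by (auto simp: is_PBD_def)
next
  have sub: "B \<subseteq> X" if "B \<in> \<B>" for B using PBD that by (auto simp: is_PBD_def)
  fix u v assume "u \<in> h ` X" "v \<in> h ` X" "u \<noteq> v"
  then obtain x y where xy: "x \<in> X" "y \<in> X" "u = h x" "v = h y" "x \<noteq> y" by blast
  have mem: "h z \<in> h ` B \<longleftrightarrow> z \<in> B" if "z \<in> X" "B \<in> \<B>" for z B
    using inj_on_image_mem_iff[OF inj that(1) sub[OF that(2)]] .
  note ex1 = is_PBD_ex1[OF PBD xy(1,2,5)]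
  from ex1 obtain B where B: "B \<in> \<B>" "x \<in> B" "y \<in> B" by (elim ex1E conjE)
  show "\<exists>!C. C \<in> (`) h ` \<B> \<and> u \<in> C \<and> v \<in> C"
  proof (rule ex1I[of _ "h ` B"])
    show "h ` B \<in> (`) h ` \<B> \<and> u \<in> h ` B \<and> v \<in> h ` B" using B xy by blast
    fix C assume C: "C \<in> (`) h ` \<B> \<and> u \<in> C \<and> v \<in> C"
    then obtain D where D: "D \<in> \<B>" "C = h ` D" by blast
    then have "x \<in> D" "y \<in> D" using C xy mem[OF _ D(1)] by auto
    then have "D = B" using ex1_same[OF ex1, of D B] D(1) B by blast
    then show "C = h ` B" using D(2) by simp
  qed
qed

lemma is_flat_image: "is_flat X \<B> Y \<Longrightarrow> is_flat (h ` X) ((`) h ` \<B>) (h ` Y)"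
  unfolding is_flat_def
proof (elim conjE, intro conjI ballI impI)
  assume Y: "Y \<subseteq> X" and ex: "\<forall>x\<in>Y. \<forall>y\<in>Y. x \<noteq> y \<longrightarrow> (\<exists>B\<in>\<B>. x \<in> B \<and> y \<in> B \<and> B \<subseteq> Y)"
  show "h ` Y \<subseteq> h ` X" using Y by blast
  fix u v assume "u \<in> h ` Y" "v \<in> h ` Y" "u \<noteq> v"
  then obtain x y where xy: "x \<in> Y" "y \<in> Y" "u = h x" "v = h y" "x \<noteq> y" by blast
  then obtain B where "B \<in> \<B>" "x \<in> B" "y \<in> B" "B \<subseteq> Y" using ex by blast
  then show "\<exists>B\<in>(`) h ` \<B>. u \<in> B \<and> v \<in> B \<and> B \<subseteq> h ` Y" using xy by blast
qed

text \<open>The point type is fixed to the one of the final statement, since the constructions live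
  on pairs of a polynomial and an index.\<close>

definition has_PBD :: "nat \<Rightarrow> nat \<Rightarrow> bool" where
  "has_PBD m v \<longleftrightarrow>
     (\<exists>(X :: nat set) \<B>. is_PBD v {3, 4, 5} X \<B> \<and> three_point_flats_le m X \<B>)"

text \<open>A generated flat is an intersection, so a single flat containing the three points and of
  size at most \<open>m\<close> bounds it.\<close>

lemma has_PBD_I:
  fixes X :: "'a set"
  assumes PBD: "is_PBD v {3, 4, 5} X \<B>"
    and flat: "\<And>S. S \<subseteq> X \<Longrightarrow> card S = 3 \<Longrightarrow> \<exists>Y. is_flat X \<B> Y \<and> S \<subseteq> Y \<and> card Y \<le> m"
  shows "has_PBD m v"
proof -
  have fin: "finite X" using PBD by (simp add: is_PBD_def)
  then obtain h :: "'a \<Rightarrow> nat" where inj: "inj_on h X"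
    using finite_imp_inj_to_nat_seg by metis
  have "three_point_flats_le m (h ` X) ((`) h ` \<B>)"
    unfolding three_point_flats_le_def
  proof (intro allI impI, elim conjE)
    fix S assume S: "S \<subseteq> h ` X" "card S = 3"
    obtain T where T: "T \<subseteq> X" "S = h ` T" using S(1) by (auto simp: subset_image_iff)
    have "card T = 3" using S(2) T card_image[OF inj_on_subset[OF inj T(1)]] by simp
    then obtain Y where Y: "is_flat X \<B> Y" "T \<subseteq> Y" "card Y \<le> m" using flat T(1) by blast
    have fY: "finite Y" using Y(1) fin finite_subset by (auto simp: is_flat_def)
    have "flat_generated (h ` X) ((`) h ` \<B>) S \<subseteq> h ` Y"
      unfolding flat_generated_def using is_flat_image[OF Y(1), of h] Y(2) T(2) by blast
    then have "card (flat_generated (h ` X) ((`) h ` \<B>) S) \<le> card (h ` Y)"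
      using fY by (intro card_mono) auto
    also have "\<dots> \<le> m" using card_image_le[OF fY, of h] Y(3) by linarith
    finally show "card (flat_generated (h ` X) ((`) h ` \<B>) S) \<le> m" .
  qed
  then show ?thesis unfolding has_PBD_def using is_PBD_image[OF inj PBD] by blast
qed

text \<open>The whole point set is a flat. This settles the orders 22, 24 and 30, whose designs come
  with the weaker bound 94.\<close>

lemma has_PBD_trivial_flats: "is_PBD v {3, 4, 5} X \<B> \<Longrightarrow> v \<le> m \<Longrightarrow> has_PBD m v"
proof (rule has_PBD_I)
  assume PBD: "is_PBD v {3, 4, 5} X \<B>" and "v \<le> m"
  fix S assume "S \<subseteq> X"
  moreover have "is_flat X \<B> X" unfolding is_flat_def
  proof (intro conjI ballI impI)
    fix x y assume "x \<in> X" "y \<in> X" "x \<noteq> y"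
    then show "\<exists>B\<in>\<B>. x \<in> B \<and> y \<in> B \<and> B \<subseteq> X"
      using is_PBD_ex1[OF PBD, of x y] is_PBD_block(1)[OF PBD] by blast
  qed simp
  moreover have "card X \<le> m" using PBD \<open>v \<le> m\<close> by (simp add: is_PBD_def)
  ultimately show "\<exists>Y. is_flat X \<B> Y \<and> S \<subseteq> Y \<and> card Y \<le> m" by blast
qed

lemma PBD_transfer:
  assumes "is_PBD (card X) K X' \<B>'" "finite X"
  shows "\<exists>\<B>. is_PBD (card X) K X \<B>"
proof -
  have "finite X'" "card X' = card X" using assms by (auto simp: is_PBD_def)
  then obtain h where h: "bij_betw h X' X" using assms(2) finite_same_card_bij by blast
  then show ?thesis using is_PBD_image[OF _ assms(1), of h] by (auto simp: bij_betw_def)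
qed

lemma is_gdd_transfer:
  assumes G: "is_gdd u I G" and s: "inj_on s I" and f: "\<And>j. j \<in> I \<Longrightarrow> f (s j) = u j"
  shows "\<exists>G'. is_gdd f (s ` I) G'"
proof -
  define h where "h = map_prod s (id :: nat \<Rightarrow> nat)"
  have inj: "inj_on h (fib u I)" using s by (auto simp: h_def fib_def inj_on_def)
  have img: "h ` fib u I = fib f (s ` I)" using f by (force simp: h_def fib_def image_iff)
  have sub: "B \<subseteq> fib u I" if "B \<in> G" for B using G that by (auto simp: is_gdd_def)
  have mem: "h z \<in> h ` B \<longleftrightarrow> z \<in> B" if "z \<in> fib u I" "B \<in> G" for z B
    using inj_on_image_mem_iff[OF inj that(1) sub[OF that(2)]] .
  have "is_gdd f (s ` I) ((`) h ` G)"
    unfolding is_gdd_def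
  proof (intro conjI ballI impI)
    fix C assume "C \<in> (`) h ` G"
    then obtain B where B: "B \<in> G" "C = h ` B" by blast
    show "C \<subseteq> fib f (s ` I)" using B sub img by blast
    show "card C \<in> {3, 4, 5}"
      using B card_image[OF inj_on_subset[OF inj sub[OF B(1)]]] G by (auto simp: is_gdd_def)
    have inj1: "inj_on fst B" using G B(1) by (auto simp: is_gdd_def)
    show "inj_on fst C"
    proof (rule inj_onI)
      fix a b assume ab: "a \<in> C" "b \<in> C" "fst a = fst b"
      then obtain a' b' where a': "a' \<in> B" "b' \<in> B" "a = h a'" "b = h b'" using B(2) by blast
      then have "fst a' \<in> I" "fst b' \<in> I" using sub[OF B(1)] by (auto simp: fib_def)
      then have "fst a' = fst b'" using ab(3) a' s by (auto simp: h_def inj_on_def)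
      then have "a' = b'" using inj1 a'(1,2) by (auto simp: inj_on_def)
      then show "a = b" using a' by simp
    qed
  next
    fix p q assume pq: "p \<in> fib f (s ` I)" "q \<in> fib f (s ` I)" "fst p \<noteq> fst q"
    then obtain x y where xy: "x \<in> fib u I" "y \<in> fib u I" "p = h x" "q = h y"
      unfolding img[symmetric] by blast
    then have "fst x \<noteq> fst y" using pq(3) by (auto simp: h_def)
    note ex1 = is_gdd_ex1[OF G xy(1,2) this]
    from ex1 obtain B where B: "B \<in> G" "x \<in> B" "y \<in> B" by (elim ex1E conjE)
    show "\<exists>!C. C \<in> (`) h ` G \<and> p \<in> C \<and> q \<in> C"
    proof (rule ex1I[of _ "h ` B"])
      show "h ` B \<in> (`) h ` G \<and> p \<in> h ` B \<and> q \<in> h ` B" using B xy by blast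
      fix C assume C: "C \<in> (`) h ` G \<and> p \<in> C \<and> q \<in> C"
      then obtain D where D: "D \<in> G" "C = h ` D" by blast
      then have "x \<in> D" "y \<in> D" using C xy mem[OF _ D(1)] by auto
      then have "D = B" using ex1_same[OF ex1, of D B] D(1) B by blast
      then show "C = h ` B" using D(2) by simp
    qed
  qed
  then show ?thesis by blast
qed

text \<open>Since the neighbour list nb of p covers all points outside the group of p and has the right
  length, it has no repetitions and stays outside the group.\<close>

definition gdd_check :: "'a list list \<Rightarrow> 'a list list \<Rightarrow> bool" where
  "gdd_check gs bs \<longleftrightarrow>
     (let pts = concat gs in distinct pts \<and>
      list_all (\<lambda>b. (let n = length b in n = 3 \<or> n = 4 \<or> n = 5) \<and> distinct b \<and>
        list_all (List.member pts) b) bs \<and>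
      list_all (\<lambda>g. let rest = filter (\<lambda>q. \<not> List.member g q) pts in
        list_all (\<lambda>p. let nb = concat (map (filter (\<lambda>q. q \<noteq> p)) (filter (\<lambda>b. List.member b p) bs)) in
          length nb = length rest \<and> list_all (List.member nb) rest) g) gs)"

section \<open>Correctness of the executable design check\<close>

lemma distinct_concat_index:
  "distinct (concat gs) \<Longrightarrow> j < length gs \<Longrightarrow> k < length gs \<Longrightarrow>
    x \<in> set (gs ! j) \<Longrightarrow> x \<in> set (gs ! k) \<Longrightarrow> j = k"
proof (induction gs arbitrary: j k)
  case (Cons g gs)
  have disj: "x \<in> set g \<Longrightarrow> i < length gs \<Longrightarrow> x \<notin> set (gs ! i)" for i
    using Cons.prems(1) nth_mem[of i gs] by (simp add: disjoint_iff)
  show ?case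
    using Cons.prems Cons.IH disj by (cases j; cases k) auto
qed simp

lemma gdd_check_sound:
  assumes "gdd_check gs bs"
  shows "\<exists>G. is_gdd (\<lambda>j. length (gs ! j)) {..<length gs} G"
proof -
  define pts where "pts = concat gs"
  define nb where "nb p = concat (map (filter (\<lambda>q. q \<noteq> p)) (filter (\<lambda>b. p \<in> set b) bs))" for p
  define rest where "rest g = filter (\<lambda>q. q \<notin> set g) pts" for g
  have dist: "distinct pts"
    using assms by (simp add: gdd_check_def Let_def pts_def)
  have blk: "length b \<in> {3, 4, 5} \<and> distinct b \<and> set b \<subseteq> set pts" if "b \<in> set bs" for b
    using assms that unfolding gdd_check_def Let_def pts_def[symmetric] list_all_iff by auto
  have nbr: "length (nb p) = length (rest g) \<and> set (rest g) \<subseteq> set (nb p)"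
    if "g \<in> set gs" "p \<in> set g" for g p
    using assms that unfolding gdd_check_def Let_def pts_def[symmetric] list_all_iff nb_def rest_def
    by (simp add: subset_iff)
  have nb_rest: "set (nb p) = set (rest g) \<and> distinct (nb p)" if "g \<in> set gs" "p \<in> set g" for g p
  proof -
    note N = nbr[OF that]
    have dr: "distinct (rest g)" using dist by (simp add: rest_def)
    have "card (set (nb p)) \<le> card (set (rest g))"
      using card_length[of "nb p"] N distinct_card[OF dr] by simp
    then have eq: "set (rest g) = set (nb p)" using N by (intro card_seteq) auto
    then have "card (set (nb p)) = length (nb p)" using N distinct_card[OF dr] by simp
    then show ?thesis using eq card_distinct by blast
  qed
  define D where "D = fib (\<lambda>j. length (gs ! j)) {..<length gs}"
  define enc where "enc d = gs ! fst d ! snd d" for d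
  have D: "d \<in> D \<longleftrightarrow> fst d < length gs \<and> snd d < length (gs ! fst d)" for d
    by (cases d) (simp add: D_def fib_def)
  have enc_group: "gs ! fst d \<in> set gs" "enc d \<in> set (gs ! fst d)" if "d \<in> D" for d
    using that by (simp_all add: D enc_def)
  have enc_pts: "enc d \<in> set pts" if "d \<in> D" for d
    using enc_group[OF that] by (auto simp: pts_def)
  have inj: "inj_on enc D"
  proof (rule inj_onI)
    fix c d assume cd: "c \<in> D" "d \<in> D" "enc c = enc d"
    have "fst c = fst d"
      using distinct_concat_index[of gs "fst c" "fst d" "enc c"] dist cd enc_group(2)[OF cd(1)]
        enc_group(2)[OF cd(2)] by (simp add: pts_def D)
    moreover have "distinct (gs ! fst d)"
      using dist enc_group(1)[OF cd(2)] by (simp add: pts_def distinct_concat_iff)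
    ultimately have "snd c = snd d" using cd by (simp add: enc_def D nth_eq_iff_index_eq)
    then show "c = d" using \<open>fst c = fst d\<close> by (simp add: prod_eq_iff)
  qed
  have surj: "\<exists>d\<in>D. enc d = p" if p: "p \<in> set pts" for p
  proof -
    obtain g where g: "g \<in> set gs" "p \<in> set g" using p by (auto simp: pts_def)
    obtain j where j: "j < length gs" "gs ! j = g" using g(1) by (auto simp: in_set_conv_nth)
    obtain i where i: "i < length g" "g ! i = p" using g(2) by (auto simp: in_set_conv_nth)
    have "(j, i) \<in> D" "enc (j, i) = p" using i j by (simp_all add: D enc_def)
    then show ?thesis by blast
  qed
  define G where "G = (\<lambda>b. {d \<in> D. enc d \<in> set b}) ` set bs"
  have nb_mem: "q \<in> set (nb p) \<longleftrightarrow> (\<exists>b\<in>set bs. p \<in> set b \<and> q \<in> set b \<and> q \<noteq> p)" for p q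
    by (auto simp: nb_def)
  have rest_mem: "enc d \<in> set (rest (gs ! fst c)) \<longleftrightarrow> fst d \<noteq> fst c" if "c \<in> D" "d \<in> D" for c d
  proof -
    have "enc d \<in> set (gs ! fst c) \<longleftrightarrow> fst d = fst c"
      using distinct_concat_index[of gs "fst d" "fst c" "enc d"] dist that enc_group(2)[OF that(2)]
      by (auto simp: pts_def D)
    then show ?thesis using enc_pts[OF that(2)] by (simp add: rest_def)
  qed
  have "is_gdd (\<lambda>j. length (gs ! j)) {..<length gs} G"
    unfolding is_gdd_def D_def[symmetric]
  proof (intro conjI ballI impI)
    fix B assume "B \<in> G"
    then obtain b where b: "b \<in> set bs" "B = {d \<in> D. enc d \<in> set b}" by (auto simp: G_def)
    show "B \<subseteq> D" using b(2) by blast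
    have "enc ` B = set b"
    proof
      show "enc ` B \<subseteq> set b" using b(2) by blast
      show "set b \<subseteq> enc ` B" using blk[OF b(1)] surj b(2) by blast
    qed
    moreover have "inj_on enc B" using inj b(2) by (rule_tac inj_on_subset) auto
    ultimately have "card B = length b" using blk[OF b(1)] card_image distinct_card by metis
    then show "card B \<in> {3, 4, 5}" using blk[OF b(1)] by simp
    show "inj_on fst B"
    proof (rule inj_onI, rule ccontr)
      fix c d assume cd: "c \<in> B" "d \<in> B" "fst c = fst d" "c \<noteq> d"
      have D2: "c \<in> D" "d \<in> D" "enc c \<in> set b" "enc d \<in> set b" using cd b(2) by auto
      then have "enc d \<noteq> enc c" using inj cd(4) by (auto dest: inj_onD)
      then have "enc d \<in> set (nb (enc c))" using b(1) D2 by (auto simp: nb_mem)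
      then have "enc d \<in> set (rest (gs ! fst c))" using nb_rest[OF enc_group[OF D2(1)]] by simp
      then show False using rest_mem[OF D2(1,2)] cd(3) by simp
    qed
  next
    fix c d assume cd: "c \<in> D" "d \<in> D" "fst c \<noteq> fst d"
    have nbs: "set (nb (enc c)) = set (rest (gs ! fst c))" "distinct (nb (enc c))"
      using nb_rest[OF enc_group[OF cd(1)]] by auto
    have "enc d \<in> set (nb (enc c))" using nbs(1) rest_mem[OF cd(1,2)] cd(3) by simp
    then obtain b where b: "b \<in> set bs" "enc c \<in> set b" "enc d \<in> set b" "enc d \<noteq> enc c"
      unfolding nb_mem by blast
    show "\<exists>!B. B \<in> G \<and> c \<in> B \<and> d \<in> B"
    proof (rule ex1I[of _ "{x \<in> D. enc x \<in> set b}"])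
      show "{x \<in> D. enc x \<in> set b} \<in> G \<and> c \<in> {x \<in> D. enc x \<in> set b} \<and> d \<in> {x \<in> D. enc x \<in> set b}"
        using b cd by (simp add: G_def)
      fix C assume C: "C \<in> G \<and> c \<in> C \<and> d \<in> C"
      then obtain a where a: "a \<in> set bs" "C = {x \<in> D. enc x \<in> set a}" by (auto simp: G_def)
      have ea: "enc c \<in> set a" "enc d \<in> set a" using C a(2) by auto
      let ?f = "filter (\<lambda>q. q \<noteq> enc c)"
      let ?L = "map ?f (filter (\<lambda>b. enc c \<in> set b) bs)"
      have mem: "?f b \<in> set ?L" "?f a \<in> set ?L" using a(1) b(1,2) ea(1) by auto
      have "enc d \<in> set (?f b) \<inter> set (?f a)" using b(3,4) ea(2) by simp
      moreover have "distinct (concat ?L)" using nbs(2) by (simp only: nb_def)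
      \<comment> \<open>The neighbour list has no repetitions, so two of its constituent lists that
        share \<open>enc d\<close> must be the same list.\<close>
      ultimately have "?f a = ?f b"
        using mem unfolding distinct_concat_iff by blast
      then have "set (?f a) = set (?f b)" by simp
      then have "set a - {enc c} = set b - {enc c}" by (simp add: set_diff_eq)
      then have "set a = set b" using b(2) ea(1) by blast
      then show "C = {x \<in> D. enc x \<in> set b}" using a(2) by simp
    qed
  qed
  then show ?thesis by blast
qed

lemma gdd_check_list:
  assumes "gdd_check gs bs" "distinct xs" "map f xs = map length gs"
  shows "\<exists>G. is_gdd f (set xs) G"
proof -
  have len: "length xs = length gs" using assms(3) by (rule map_eq_imp_length_eq)
  obtain G where G: "is_gdd (\<lambda>j. length (gs ! j)) {..<length gs} G"
    using gdd_check_sound[OF assms(1)] by blast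
  have inj: "inj_on ((!) xs) {..<length gs}"
    using assms(2) len by (auto simp: inj_on_def nth_eq_iff_index_eq)
  have "f (xs ! j) = length (gs ! j)" if "j \<in> {..<length gs}" for j
    using arg_cong[OF assms(3), of "\<lambda>l. l ! j"] that len by simp
  moreover have "(!) xs ` {..<length gs} = set xs"
    unfolding len[symmetric] set_conv_nth by auto
  ultimately show ?thesis using is_gdd_transfer[OF G inj, of f] by metis
qed

section \<open>Small group divisible designs\<close>

text \<open>Only the group sizes are remembered: a witness is checked once on integers and then
  transferred to every line with these weights.\<close>

definition gdd_type :: "nat list \<Rightarrow> bool" where
  "gdd_type ws \<longleftrightarrow> (\<exists>gs bs :: int list list. gdd_check gs bs \<and> map length gs = ws)"

lemma gdd_typeI: "gdd_check (gs :: int list list) bs \<Longrightarrow> map length gs = ws \<Longrightarrow> gdd_type ws"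
  unfolding gdd_type_def by blast

lemma is_gdd_support: "fib w l = fib w k \<Longrightarrow> is_gdd w l = is_gdd w k"
  unfolding is_gdd_def fun_eq_iff by simp

text \<open>Points of weight 0 contribute nothing to \<open>fib f l\<close>, so the list
  \<open>xs\<close> need not contain them.\<close>

lemma gdd_type_line:
  assumes "gdd_type ws" "distinct xs" "map f xs = ws" "set xs \<subseteq> l" "\<And>x. x \<in> l - set xs \<Longrightarrow> f x = 0"
  shows "\<exists>G. is_gdd f l G"
proof -
  have "fib f l = fib f (set xs)"
    using assms(4,5) unfolding fib_def by fastforce
  moreover obtain gs bs :: "int list list" where "gdd_check gs bs" "map length gs = ws"
    using assms(1) unfolding gdd_type_def by blast
  ultimately show ?thesis
    using gdd_check_list[of gs bs xs f] assms(2,3) is_gdd_support[of f l "set xs"] by simp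
qed

section \<open>Designs with groups of sizes 1 and 3\<close>

lemma gdd_empty: "gdd_type []"
proof (rule gdd_typeI)
  show "gdd_check ([] :: int list list)
    []"
    by code_simp
qed simp

lemma gdd_3: "gdd_type [3]"
proof (rule gdd_typeI)
  show "gdd_check ([[0, 1, 2]] :: int list list)
    []"
    by code_simp
qed simp

lemma gdd_1: "gdd_type [1]"
proof (rule gdd_typeI)
  show "gdd_check ([[0]] :: int list list)
    []"
    by code_simp
qed simp

lemma gdd_1_1_1: "gdd_type [1, 1, 1]"
proof (rule gdd_typeI)
  show "gdd_check ([[0], [1], [2]] :: int list list)
    [[0, 1, 2]]"
    by code_simp
qed simp

lemma gdd_1_1_1_1: "gdd_type [1, 1, 1, 1]"
proof (rule gdd_typeI)
  show "gdd_check ([[0], [1], [2], [3]] :: int list list)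
    [[0, 1, 2, 3]]"
    by code_simp
qed simp

lemma gdd_1_1_1_1_1: "gdd_type [1, 1, 1, 1, 1]"
proof (rule gdd_typeI)
  show "gdd_check ([[0], [1], [2], [3], [4]] :: int list list)
    [[0, 1, 2, 3, 4]]"
    by code_simp
qed simp

lemma gdd_3_1_1_1_1: "gdd_type [3, 1, 1, 1, 1]"
proof (rule gdd_typeI)
  show "gdd_check ([[0, 1, 2], [3], [4], [5], [6]] :: int list list)
    [[0, 3, 6], [0, 4, 5], [1, 3, 5], [1, 4, 6], [2, 3, 4], [2, 5, 6]]"
    by code_simp
qed simp

lemma gdd_3_3_1_1_1: "gdd_type [3, 3, 1, 1, 1]"
proof (rule gdd_typeI)
  show "gdd_check ([[0, 1, 2], [3, 4, 5], [6], [7], [8]] :: int list list)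
    [[0, 3, 7], [0, 4, 8], [0, 5, 6], [1, 3, 6], [1, 4, 7], [1, 5, 8], [2, 3, 8], [2, 4, 6],
      [2, 5, 7], [6, 7, 8]]"
    by code_simp
qed simp

lemma gdd_3_3_3_1_1: "gdd_type [3, 3, 3, 1, 1]"
proof (rule gdd_typeI)
  show "gdd_check ([[0, 1, 2], [3, 4, 5], [6, 7, 8], [9], [10]] :: int list list)
    [[0, 3, 6, 9, 10], [0, 4, 7], [0, 5, 8], [1, 3, 7], [1, 4, 6], [1, 5, 10], [1, 8, 9],
      [2, 3, 8], [2, 4, 9], [2, 5, 6], [2, 7, 10], [4, 8, 10], [5, 7, 9]]"
    by code_simp
qed simp

lemma gdd_3_3_3_3_1: "gdd_type [3, 3, 3, 3, 1]"
proof (rule gdd_typeI)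
  show "gdd_check ([[0, 1, 2], [3, 4, 5], [6, 7, 8], [9, 10, 11], [12]] :: int list list)
    [[0, 3, 6], [0, 4, 9], [0, 5, 7], [0, 8, 10], [0, 11, 12], [1, 3, 11], [1, 4, 6], [1, 5,
      12], [1, 7, 10], [1, 8, 9], [2, 3, 10], [2, 4, 8], [2, 5, 9], [2, 6, 11], [2, 7, 12],
      [3, 7, 9], [3, 8, 12], [4, 7, 11], [4, 10, 12], [5, 6, 10], [5, 8, 11], [6, 9, 12]]"
    by code_simp
qed simp

lemma gdd_3_3_3_3_3: "gdd_type [3, 3, 3, 3, 3]"
proof (rule gdd_typeI)
  show "gdd_check ([[0, 1, 2], [3, 4, 5], [6, 7, 8], [9, 10, 11], [12, 13, 14]] :: int list list)
    [[0, 3, 6], [0, 4, 9], [0, 5, 14], [0, 7, 10], [0, 8, 13], [0, 11, 12], [1, 3, 13], [1,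
      4, 14], [1, 5, 11], [1, 6, 10], [1, 7, 12], [1, 8, 9], [2, 3, 10], [2, 4, 6], [2, 5, 8],
      [2, 7, 14], [2, 9, 12], [2, 11, 13], [3, 7, 11], [3, 8, 12], [3, 9, 14], [4, 7, 13], [4,
      8, 11], [4, 10, 12], [5, 6, 12], [5, 7, 9], [5, 10, 13], [6, 9, 13], [6, 11, 14], [8,
      10, 14]]"
    by code_simp
qed simp

lemma gdd_3_3_3: "gdd_type [3, 3, 3]"
proof (rule gdd_typeI)
  show "gdd_check ([[0, 1, 2], [3, 4, 5], [6, 7, 8]] :: int list list)
    [[0, 3, 7], [0, 4, 6], [0, 5, 8], [1, 3, 6], [1, 4, 8], [1, 5, 7], [2, 3, 8], [2, 4, 7],
      [2, 5, 6]]"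
    by code_simp
qed simp

lemma gdd_3_3_3_1: "gdd_type [3, 3, 3, 1]"
proof (rule gdd_typeI)
  show "gdd_check ([[0, 1, 2], [3, 4, 5], [6, 7, 8], [9]] :: int list list)
    [[0, 3, 6, 9], [0, 4, 8], [0, 5, 7], [1, 3, 8], [1, 4, 7, 9], [1, 5, 6], [2, 3, 7], [2,
      4, 6], [2, 5, 8, 9]]"
    by code_simp
qed simp

text \<open>The projective plane of order 3 without a point; the groups are the lines through that
  point.\<close>

lemma gdd_3_3_3_3: "gdd_type [3, 3, 3, 3]"
proof (rule gdd_typeI)
  show "gdd_check ([[0, 1, 2], [3, 4, 5], [6, 7, 8], [9, 10, 11]] :: int list list)
    [[0, 3, 7, 10], [0, 4, 6, 9], [0, 5, 8, 11], [1, 3, 8, 9], [1, 4, 7, 11], [1, 5, 6, 10],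
      [2, 3, 6, 11], [2, 4, 8, 10], [2, 5, 7, 9]]"
    by code_simp
qed simp

section \<open>Designs with four groups of size 4\<close>

text \<open>The projective plane of order 4 without a point. The points of the last group split the
  16 blocks into four parallel classes on the other groups; deleting some of these points gives the
  next three designs.\<close>

lemma gdd_4_4_4_4_4: "gdd_type [4, 4, 4, 4, 4]"
proof (rule gdd_typeI)
  show "gdd_check ([[0, 1, 2, 3], [4, 5, 6, 7], [8, 9, 10, 11], [12, 13, 14, 15], [16, 17, 18, 19]] :: int list list)
    [[0, 4, 8, 12, 16], [1, 5, 9, 13, 16], [2, 6, 10, 14, 16], [3, 7, 11, 15, 16], [0, 5,
      10, 15, 17], [1, 4, 11, 14, 17], [2, 7, 8, 13, 17], [3, 6, 9, 12, 17], [0, 6, 11, 13,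
      18], [1, 7, 10, 12, 18], [2, 4, 9, 15, 18], [3, 5, 8, 14, 18], [0, 7, 9, 14, 19], [1, 6,
      8, 15, 19], [2, 5, 11, 12, 19], [3, 4, 10, 13, 19]]"
    by code_simp
qed simp

lemma gdd_4_4_4_4: "gdd_type [4, 4, 4, 4]"
proof (rule gdd_typeI)
  show "gdd_check ([[0, 1, 2, 3], [4, 5, 6, 7], [8, 9, 10, 11], [12, 13, 14, 15]] :: int list list)
    [[0, 4, 8, 12], [1, 5, 9, 13], [2, 6, 10, 14], [3, 7, 11, 15], [0, 5, 10, 15], [1, 4,
      11, 14], [2, 7, 8, 13], [3, 6, 9, 12], [0, 6, 11, 13], [1, 7, 10, 12], [2, 4, 9, 15],
      [3, 5, 8, 14], [0, 7, 9, 14], [1, 6, 8, 15], [2, 5, 11, 12], [3, 4, 10, 13]]"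
    by code_simp
qed simp

lemma gdd_4_4_4_4_1: "gdd_type [4, 4, 4, 4, 1]"
proof (rule gdd_typeI)
  show "gdd_check ([[0, 1, 2, 3], [4, 5, 6, 7], [8, 9, 10, 11], [12, 13, 14, 15], [16]] :: int list list)
    [[0, 4, 8, 12, 16], [1, 5, 9, 13, 16], [2, 6, 10, 14, 16], [3, 7, 11, 15, 16], [0, 5,
      10, 15], [1, 4, 11, 14], [2, 7, 8, 13], [3, 6, 9, 12], [0, 6, 11, 13], [1, 7, 10, 12],
      [2, 4, 9, 15], [3, 5, 8, 14], [0, 7, 9, 14], [1, 6, 8, 15], [2, 5, 11, 12], [3, 4, 10,
      13]]"
    by code_simp
qed simp

lemma gdd_4_4_4_4_3: "gdd_type [4, 4, 4, 4, 3]"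
proof (rule gdd_typeI)
  show "gdd_check ([[0, 1, 2, 3], [4, 5, 6, 7], [8, 9, 10, 11], [12, 13, 14, 15], [16, 17, 18]] :: int list list)
    [[0, 4, 8, 12, 16], [1, 5, 9, 13, 16], [2, 6, 10, 14, 16], [3, 7, 11, 15, 16], [0, 5,
      10, 15, 17], [1, 4, 11, 14, 17], [2, 7, 8, 13, 17], [3, 6, 9, 12, 17], [0, 6, 11, 13,
      18], [1, 7, 10, 12, 18], [2, 4, 9, 15, 18], [3, 5, 8, 14, 18], [0, 7, 9, 14], [1, 6, 8,
      15], [2, 5, 11, 12], [3, 4, 10, 13]]"
    by code_simp
qed simp

text \<open>The four parallel classes of \<open>gdd_4_4_4_4\<close> receive 3 + 3 + 1 + 0 new
  points. In a class that receives three, every block is broken up: its three partitions into two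
  pairs are joined to the three new points.\<close>

lemma gdd_4_4_4_4_7: "gdd_type [4, 4, 4, 4, 7]"
proof (rule gdd_typeI)
  show "gdd_check ([[0, 1, 2, 3], [4, 5, 6, 7], [8, 9, 10, 11], [12, 13, 14, 15], [16, 17, 18, 19, 20, 21, 22]] :: int list list)
    [[0, 4, 16], [8, 12, 16], [0, 8, 17], [4, 12, 17], [0, 12, 18], [4, 8, 18], [1, 5, 16],
      [9, 13, 16], [1, 9, 17], [5, 13, 17], [1, 13, 18], [5, 9, 18], [2, 6, 16], [10, 14, 16],
      [2, 10, 17], [6, 14, 17], [2, 14, 18], [6, 10, 18], [3, 7, 16], [11, 15, 16], [3, 11,
      17], [7, 15, 17], [3, 15, 18], [7, 11, 18], [0, 5, 19], [10, 15, 19], [0, 10, 20], [5,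
      15, 20], [0, 15, 21], [5, 10, 21], [1, 4, 19], [11, 14, 19], [1, 11, 20], [4, 14, 20],
      [1, 14, 21], [4, 11, 21], [2, 7, 19], [8, 13, 19], [2, 8, 20], [7, 13, 20], [2, 13, 21],
      [7, 8, 21], [3, 6, 19], [9, 12, 19], [3, 9, 20], [6, 12, 20], [3, 12, 21], [6, 9, 21],
      [0, 6, 11, 13, 22], [1, 7, 10, 12, 22], [2, 4, 9, 15, 22], [3, 5, 8, 14, 22], [0, 7, 9,
      14], [1, 6, 8, 15], [2, 5, 11, 12], [3, 4, 10, 13]]"
    by code_simp
qed simp

text \<open>As for seven new points, now with 3 + 3 + 3 + 1 of them for the four classes.\<close>

lemma gdd_4_4_4_4_10: "gdd_type [4, 4, 4, 4, 10]"
proof (rule gdd_typeI)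
  show "gdd_check ([[0, 1, 2, 3], [4, 5, 6, 7], [8, 9, 10, 11], [12, 13, 14, 15], [16, 17, 18, 19, 20, 21, 22, 23, 24, 25]] :: int list list)
    [[0, 4, 16], [8, 12, 16], [0, 8, 17], [4, 12, 17], [0, 12, 18], [4, 8, 18], [1, 5, 16],
      [9, 13, 16], [1, 9, 17], [5, 13, 17], [1, 13, 18], [5, 9, 18], [2, 6, 16], [10, 14, 16],
      [2, 10, 17], [6, 14, 17], [2, 14, 18], [6, 10, 18], [3, 7, 16], [11, 15, 16], [3, 11,
      17], [7, 15, 17], [3, 15, 18], [7, 11, 18], [0, 5, 19], [10, 15, 19], [0, 10, 20], [5,
      15, 20], [0, 15, 21], [5, 10, 21], [1, 4, 19], [11, 14, 19], [1, 11, 20], [4, 14, 20],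
      [1, 14, 21], [4, 11, 21], [2, 7, 19], [8, 13, 19], [2, 8, 20], [7, 13, 20], [2, 13, 21],
      [7, 8, 21], [3, 6, 19], [9, 12, 19], [3, 9, 20], [6, 12, 20], [3, 12, 21], [6, 9, 21],
      [0, 6, 22], [11, 13, 22], [0, 11, 23], [6, 13, 23], [0, 13, 24], [6, 11, 24], [1, 7,
      22], [10, 12, 22], [1, 10, 23], [7, 12, 23], [1, 12, 24], [7, 10, 24], [2, 4, 22], [9,
      15, 22], [2, 9, 23], [4, 15, 23], [2, 15, 24], [4, 9, 24], [3, 5, 22], [8, 14, 22], [3,
      8, 23], [5, 14, 23], [3, 14, 24], [5, 8, 24], [0, 7, 9, 14, 25], [1, 6, 8, 15, 25], [2,
      5, 11, 12, 25], [3, 4, 10, 13, 25]]"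
    by code_simp
qed simp

section \<open>Designs from Latin squares\<close>

text \<open>The addition table modulo 7 with the orthogonal square \<open>i + 2 * j\<close>: each
  value of the latter marks a parallel class of triples. The class of the value 0 is extended by the
  extra point.\<close>

lemma gdd_7_7_7_1: "gdd_type [7, 7, 7, 1]"
proof (rule gdd_typeI)
  show "gdd_check ([[0, 1, 2, 3, 4, 5, 6], [7, 8, 9, 10, 11, 12, 13], [14, 15, 16, 17, 18, 19, 20], [21]] :: int list list)
    [[i, 7 + j, 14 + (i + j) mod 7] @
      (if (i + 2 * j) mod 7 < 1 then [21 + (i + 2 * j) mod 7] else []).
      i \<leftarrow> [0, 1, 2, 3, 4, 5, 6], j \<leftarrow> [0, 1, 2, 3, 4, 5, 6]]"
    by code_simp
qed simp

text \<open>The same pair of orthogonal squares, with the classes of the values 0, 1, 2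
  extended.\<close>

lemma gdd_7_7_7_3: "gdd_type [7, 7, 7, 3]"
proof (rule gdd_typeI)
  show "gdd_check ([[0, 1, 2, 3, 4, 5, 6], [7, 8, 9, 10, 11, 12, 13], [14, 15, 16, 17, 18, 19, 20], [21, 22, 23]] :: int list list)
    [[i, 7 + j, 14 + (i + j) mod 7] @
      (if (i + 2 * j) mod 7 < 3 then [21 + (i + 2 * j) mod 7] else []).
      i \<leftarrow> [0, 1, 2, 3, 4, 5, 6], j \<leftarrow> [0, 1, 2, 3, 4, 5, 6]]"
    by code_simp
qed simp

lemma gdd_10_10_10: "gdd_type [10, 10, 10]"
proof (rule gdd_typeI)
  show "gdd_check ([[0, 1, 2, 3, 4, 5, 6, 7, 8, 9], [10, 11, 12, 13, 14, 15, 16, 17, 18, 19], [20, 21, 22, 23, 24, 25, 26, 27, 28, 29]] :: int list list)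
    [[i, 10 + j, 20 + (i + j) mod 10].
      i \<leftarrow> [0, 1, 2, 3, 4, 5, 6, 7, 8, 9], j \<leftarrow> [0, 1, 2, 3, 4, 5, 6, 7, 8, 9]]"
    by code_simp
qed simp

section \<open>Weightings of projective space\<close>

text \<open>Pads a type with an empty group, because the types used for the heavy line must list all
  five of its points.\<close>

lemma gdd_type_append_0: "gdd_type ws \<Longrightarrow> gdd_type (ws @ [0])"
proof -
  assume "gdd_type ws"
  then obtain gs bs :: "int list list" where "gdd_check gs bs" "map length gs = ws"
    unfolding gdd_type_def by blast
  then have "gdd_check (gs @ [[]]) bs" "map length (gs @ [[]]) = ws @ [0]"
    by (simp_all add: gdd_check_def Let_def)
  then show ?thesis by (rule gdd_typeI)
qed

text \<open>The assumption \<open>bound\<close> passes on the closure of \<open>F\<close> under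
  lines. With one heavy line this matters: closure forces a plane to contain that line as soon as it
  meets it twice.\<close>

lemma PG_has_PBD:
  fixes w :: "gf4 poly \<Rightarrow> nat"
  assumes gdd: "\<And>l. l \<in> lines n \<Longrightarrow> \<exists>G. is_gdd w l G"
    and fill: "\<And>x. x \<in> PG n \<Longrightarrow> \<exists>(X :: nat set) \<B>. is_PBD (w x) {3, 4, 5} X \<B>"
    and bound: "\<And>F. F \<subseteq> PG n \<Longrightarrow> card F \<le> 21 \<Longrightarrow>
      (\<And>l x y. l \<in> lines n \<Longrightarrow> x \<in> l \<inter> F \<Longrightarrow> y \<in> l \<inter> F \<Longrightarrow> x \<noteq> y \<Longrightarrow> l \<subseteq> F) \<Longrightarrow>
      (\<Sum>x\<in>F. w x) \<le> m"
  shows "has_PBD m (\<Sum>x\<in>PG n. w x)"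
proof -
  obtain G where G: "\<And>l. l \<in> lines n \<Longrightarrow> is_gdd w l (G l)" using gdd by metis
  have "\<exists>\<B>. is_PBD (w x) {3, 4, 5} (fib w {x}) \<B>" if x: "x \<in> PG n" for x
  proof -
    have c: "card (fib w {x}) = w x" by (simp add: card_fib)
    obtain X :: "nat set" and \<B> where "is_PBD (w x) {3, 4, 5} X \<B>" using fill[OF x] by blast
    then show ?thesis using PBD_transfer[of "fib w {x}" "{3, 4, 5}" X \<B>] finite_fib[of "{x}" w]
      by (simp add: c)
  qed
  then obtain H where H: "\<And>x. x \<in> PG n \<Longrightarrow> is_PBD (w x) {3, 4, 5} (fib w {x}) (H x)" by metis
  interpret weighted_linear_space "PG n" "lines n" w G H
    by (rule weighted_linear_space.intro) (assumption | rule finite_PG line_subset ex1_line G H)+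
  show ?thesis
  proof (rule has_PBD_I[OF blocks_PBD])
    fix S assume S: "S \<subseteq> fib w (PG n)" "card S = 3"
    obtain p q r where pqr: "S = {p, q, r}" using S(2) unfolding card_3_iff by blast
    then have mem: "fst p \<in> PG n" "fst q \<in> PG n" "fst r \<in> PG n"
      using S(1) fst_in_fib[OF S(1)] by simp_all
    obtain F where F: "F \<subseteq> PG n" "fst p \<in> F" "fst q \<in> F" "fst r \<in> F" "card F \<le> 21"
      and "\<forall>l\<in>lines n. \<forall>x\<in>l \<inter> F. \<forall>y\<in>l \<inter> F. x \<noteq> y \<longrightarrow> l \<subseteq> F"
      using plane_exists[OF mem] by (elim exE conjE)
    then have cl: "l \<subseteq> F" if "l \<in> lines n" "x \<in> l \<inter> F" "y \<in> l \<inter> F" "x \<noteq> y" for l x y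
      using that by blast
    have "is_flat (fib w (PG n)) blocks (fib w F)"
      by (rule fib_flat[OF F(1)]) (rule cl)
    moreover have "S \<subseteq> fib w F" using S(1) F(2-4) unfolding pqr fib_def by auto
    moreover have "card (fib w F) \<le> m"
      unfolding card_fib[OF finite_subset[OF F(1) finite_PG]]
      by (rule bound[OF F(1,5)]) (rule cl)
    ultimately show "\<exists>Y. is_flat (fib w (PG n)) blocks Y \<and> S \<subseteq> Y \<and> card Y \<le> m" by blast
  qed
qed

lemma PBD_small: "v \<in> {0, 1, 3, 4} \<Longrightarrow> \<exists>(X :: nat set) \<B>. is_PBD v {3, 4, 5} X \<B>"
proof -
  assume v: "v \<in> {0, 1, 3, 4}"
  have "is_PBD v {3, 4, 5} {..<v} (if v \<le> 1 then {} else {{..<v}})"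
    using v unfolding is_PBD_def by auto
  then show ?thesis by blast
qed

text \<open>Numbers of points of weight 3 and of weight 1 on a line.\<close>

definition line_types :: "(nat \<times> nat) set" where
  "line_types = {(0,0), (1,0), (0,1), (0,3), (0,4), (0,5), (1,4), (2,3), (3,2), (4,1), (5,0),
     (4,0), (3,0), (3,1)}"

text \<open>Points of \<open>T\<close> carry weight 3, points of \<open>S\<close> weight 1, all
  others weight 0.\<close>

definition weighting :: "nat \<Rightarrow> gf4 poly set \<Rightarrow> gf4 poly set \<Rightarrow> bool" where
  "weighting n T S \<longleftrightarrow> T \<subseteq> PG n \<and> S \<subseteq> PG n \<and> T \<inter> S = {} \<and>
     (\<forall>l\<in>lines n. (card (T \<inter> l), card (S \<inter> l)) \<in> line_types)"

definition total_weight :: "nat \<Rightarrow> nat \<Rightarrow> bool" where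
  "total_weight n v \<longleftrightarrow> (\<exists>T S. weighting n T S \<and> v = 3 * card T + card S)"

lemma line_types_gdd:
  assumes "(a, b) \<in> line_types"
  shows "gdd_type (replicate a 3 @ replicate b 1)"
proof -
  have rep: "replicate 1 x = [x]" "replicate 2 x = [x, x]" "replicate 3 x = [x, x, x]"
    "replicate 4 x = [x, x, x, x]" "replicate 5 x = [x, x, x, x, x]" for x :: nat
    by (simp_all add: numeral_eq_Suc)
  show ?thesis
    using assms unfolding line_types_def
    by (elim insertE emptyE; simp add: rep gdd_empty gdd_3 gdd_1 gdd_1_1_1 gdd_1_1_1_1 gdd_1_1_1_1_1
      gdd_3_1_1_1_1 gdd_3_3_1_1_1 gdd_3_3_3_1_1 gdd_3_3_3_3_1 gdd_3_3_3_3_3 gdd_3_3_3 gdd_3_3_3_1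
      gdd_3_3_3_3 del: One_nat_def)
qed

lemma total_weight_PBD:
  assumes "total_weight n v"
  shows "has_PBD 63 v"
proof -
  obtain T S where W: "weighting n T S" and v: "v = 3 * card T + card S"
    using assms unfolding total_weight_def by blast
  have sub: "T \<subseteq> PG n" "S \<subseteq> PG n" "T \<inter> S = {}" using W by (auto simp: weighting_def)
  define w where "w p = (if p \<in> T then 3 else if p \<in> S then 1 else 0 :: nat)" for p
  have "\<exists>G. is_gdd w l G" if l: "l \<in> lines n" for l
  proof -
    have fin: "finite l" using line_subset[OF l] finite_PG finite_subset by blast
    obtain ts where ts: "set ts = T \<inter> l" "distinct ts" using finite_distinct_list[of "T \<inter> l"] fin by blast
    obtain ss where ss: "set ss = S \<inter> l" "distinct ss" using finite_distinct_list[of "S \<inter> l"] fin by blast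
    have len: "length ts = card (T \<inter> l)" "length ss = card (S \<inter> l)"
      using ts ss distinct_card by metis+
    have "(card (T \<inter> l), card (S \<inter> l)) \<in> line_types" using W l by (simp add: weighting_def)
    then have type: "gdd_type (replicate (length ts) 3 @ replicate (length ss) 1)"
      unfolding len by (rule line_types_gdd)
    have "map w ts = replicate (length ts) 3"
      using ts(1) by (intro replicate_eqI) (auto simp: w_def)
    moreover have "map w ss = replicate (length ss) 1"
      using ss(1) sub(3) by (intro replicate_eqI) (auto simp: w_def)
    ultimately have "map w (ts @ ss) = replicate (length ts) 3 @ replicate (length ss) 1" by simp
    moreover have "distinct (ts @ ss)" using ts ss sub(3) by auto
    moreover have "set (ts @ ss) \<subseteq> l" using ts ss by auto
    moreover have "w x = 0" if "x \<in> l - set (ts @ ss)" for x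
      using that ts ss by (auto simp: w_def)
    ultimately show ?thesis using gdd_type_line[OF type, of "ts @ ss" w l] by blast
  qed
  moreover have "\<exists>(X :: nat set) \<B>. is_PBD (w x) {3, 4, 5} X \<B>" for x
    by (rule PBD_small) (simp add: w_def)
  moreover have "(\<Sum>x\<in>F. w x) \<le> 63" if "card F \<le> 21" for F
  proof -
    have "(\<Sum>x\<in>F. w x) \<le> card F * 3" by (rule sum_bounded_above[THEN order_trans]) (auto simp: w_def)
    then show ?thesis using that by linarith
  qed
  ultimately have "has_PBD 63 (\<Sum>x\<in>PG n. w x)" by (intro PG_has_PBD) auto
  moreover have "(\<Sum>x\<in>PG n. w x) = v"
  proof -
    have "(\<Sum>x\<in>PG n. w x) = (\<Sum>x\<in>PG n. (if x \<in> T then 3 else 0) + (if x \<in> S then 1 else 0))"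
      using sub(3) by (intro sum.cong) (auto simp: w_def)
    also have "\<dots> = 3 * card (PG n \<inter> T) + card (PG n \<inter> S)"
      by (simp add: sum.distrib finite_PG flip: sum.inter_restrict)
    also have "\<dots> = v" using sub v by (simp add: Int_absorb1)
    finally show ?thesis .
  qed
  ultimately show ?thesis by simp
qed

section \<open>One heavy line\<close>

lemma PG_1_line:
  assumes "l \<in> lines n" "1 \<le> n" "x \<in> l" "y \<in> l" "x \<noteq> y" "x \<in> PG 1" "y \<in> PG 1"
  shows "l = PG 1"
proof -
  obtain k where k: "k \<in> lines 1" "x \<in> k" "y \<in> k"
    using ex1_line[OF assms(6,7,5)] by blast
  have "k \<in> lines n" using k(1) PG_mono[OF assms(2)] unfolding lines_def by blast
  moreover have "x \<in> PG n" "y \<in> PG n" using line_subset[OF assms(1)] assms(3,4) by auto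
  ultimately have "l = k" using ex1_same[OF ex1_line[of x n y], of l k] assms k by blast
  moreover have "k = PG 1"
    using line_subset[OF k(1)] card_line[OF k(1)] finite_PG[of 1]
    by (intro card_subset_eq) (simp_all add: card_PG bracket4_def)
  ultimately show ?thesis by simp
qed

text \<open>All points have weight 4 except those of the line \<^term>\<open>PG 1\<close>, whose total weight
  exceeds 20 by at most 10; a plane through that line has total weight at most 84 + 10.\<close>

lemma heavy_line_PBD:
  assumes n: "1 \<le> n" and us: "length us = 5" "sum_list us \<le> 30" "gdd_type us"
    and u: "\<And>u. u \<in> set us \<Longrightarrow> u \<le> 10 \<and> gdd_type [4, 4, 4, 4, u] \<and>
      (\<exists>(X :: nat set) \<B>. is_PBD u {3, 4, 5} X \<B>)"
  shows "has_PBD 94 (4 * (bracket4 n - 5) + sum_list us)"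
proof -
  have c1: "card (PG 1) = 5" by (simp add: card_PG bracket4_def)
  obtain xs where xs: "set xs = PG 1" "distinct xs"
    using finite_distinct_list[OF finite_PG] by blast
  have len: "length xs = length us" using xs us(1) distinct_card[of xs] c1 by simp
  define f where "f x = the (map_of (zip xs us) x)" for x
  define w where "w x = (if x \<in> PG 1 then f x else 4)" for x
  have map_f: "map f xs = us"
    using len xs(2) by (intro nth_equalityI) (simp_all add: f_def map_of_zip_nth)
  have "map w xs = map f xs" using xs(1) by (simp add: w_def)
  then have map_w: "map w xs = us" using map_f by simp
  have w1: "w x \<in> set us" if "x \<in> PG 1" for x
    using that xs(1) unfolding map_w[symmetric] by auto
  have sum1: "(\<Sum>x\<in>PG 1. w x) = sum_list us"
    unfolding map_w[symmetric] xs(1)[symmetric] using xs(2) by (simp add: sum_list_distinct_conv_sum_set)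
  have w4: "w x = 4" if "x \<notin> PG 1" for x using that by (simp add: w_def)
  have "\<exists>G. is_gdd w l G" if l: "l \<in> lines n" for l
  proof (cases "l = PG 1")
    case True
    then show ?thesis using gdd_type_line[OF us(3) xs(2) map_w, of l] xs(1) by blast
  next
    case False
    have fin: "finite l" using line_subset[OF l] finite_PG finite_subset by blast
    have one: "x = y" if "x \<in> l \<inter> PG 1" "y \<in> l \<inter> PG 1" for x y
      using PG_1_line[OF l n, of x y] that False by blast
    \<comment> \<open>The exceptional point \<open>x\<close> is the intersection with the heavy
      line, or any point of \<open>l\<close> if the two are disjoint; the other four have weight
      4.\<close>
    have "\<exists>x\<in>l. \<forall>y\<in>l - {x}. y \<notin> PG 1"
    proof (cases "l \<inter> PG 1 = {}")
      case True
      have "l \<noteq> {}" using card_line[OF l] by auto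
      then show ?thesis using True by blast
    next
      case False
      then show ?thesis using one by blast
    qed
    then obtain x where x: "x \<in> l" "\<And>y. y \<in> l - {x} \<Longrightarrow> y \<notin> PG 1" by blast
    obtain ys where ys: "set ys = l - {x}" "distinct ys"
      using finite_distinct_list[of "l - {x}"] fin by blast
    have "length ys = 4" using ys distinct_card[of ys] card_line[OF l] x(1) by simp
    moreover have "map w ys = replicate (length ys) 4"
      using ys(1) x(2) w4 by (intro replicate_eqI) auto
    ultimately have "map w (ys @ [x]) = [4, 4, 4, 4, w x]" by (simp add: numeral_eq_Suc)
    moreover have "gdd_type [4, 4, 4, 4, w x]"
    proof (cases "x \<in> PG 1")
      case True
      then show ?thesis using u w1 by blast
    next
      case False
      then show ?thesis using gdd_4_4_4_4_4 by (simp add: w4)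
    qed
    moreover have "distinct (ys @ [x])" "set (ys @ [x]) = l" using ys x(1) by auto
    ultimately show ?thesis using gdd_type_line[of _ "ys @ [x]" w l] by simp
  qed
  moreover have "\<exists>(X :: nat set) \<B>. is_PBD (w x) {3, 4, 5} X \<B>" for x
  proof (cases "x \<in> PG 1")
    case True
    then show ?thesis using u w1 by blast
  next
    case False
    then show ?thesis using PBD_small[of 4] by (simp add: w4)
  qed
  moreover have "(\<Sum>x\<in>F. w x) \<le> 94" if F: "F \<subseteq> PG n" "card F \<le> 21"
    and cl: "\<And>l x y. l \<in> lines n \<Longrightarrow> x \<in> l \<inter> F \<Longrightarrow> y \<in> l \<inter> F \<Longrightarrow> x \<noteq> y \<Longrightarrow> l \<subseteq> F" for F
  proof -
    have fin: "finite F" using F(1) finite_PG finite_subset by blast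
    have "(\<Sum>x\<in>F. w x) = (\<Sum>x\<in>F \<inter> PG 1. w x) + (\<Sum>x\<in>F - PG 1. w x)"
      using fin by (subst sum.Int_Diff[of F _ "PG 1"]) simp_all
    also have "(\<Sum>x\<in>F - PG 1. w x) = (\<Sum>x\<in>F - PG 1. 4)" by (intro sum.cong) (simp_all add: w4)
    finally have sum: "(\<Sum>x\<in>F. w x) = (\<Sum>x\<in>F \<inter> PG 1. w x) + 4 * card (F - PG 1)" by simp
    have card_diff: "card (F - PG 1) = card F - card (F \<inter> PG 1)"
      using fin by (simp add: card_Diff_subset_Int)
    \<comment> \<open>A plane containing the heavy line has weight at most 30 + 4 * 16 = 94;
      otherwise it has at most one heavy point, giving at most 10 + 4 * 20 = 90.\<close>
    show ?thesis
    proof (cases "\<exists>x\<in>F \<inter> PG 1. \<exists>y\<in>F \<inter> PG 1. x \<noteq> y")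
      case True
      then obtain x y where xy: "x \<in> F" "x \<in> PG 1" "y \<in> F" "y \<in> PG 1" "x \<noteq> y" by blast
      obtain l where l: "l \<in> lines n" "x \<in> l" "y \<in> l"
        using ex1_line[of x n y] xy PG_mono[OF n] by blast
      then have "l = PG 1" using PG_1_line[OF l(1) n] xy by blast
      then have "PG 1 \<subseteq> F" using cl[OF l(1)] l xy by blast
      then have "F \<inter> PG 1 = PG 1" by blast
      then show ?thesis using sum card_diff sum1 us(2) F(2) c1 by simp
    next
      case False
      then have "card (F \<inter> PG 1) \<le> 1" using card_le_Suc0_iff_eq[of "F \<inter> PG 1"] fin by simp
      moreover have "(\<Sum>x\<in>F \<inter> PG 1. w x) \<le> card (F \<inter> PG 1) * 10"
        using u w1 by (intro sum_bounded_above[THEN order_trans]) auto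
      ultimately show ?thesis using sum card_diff F(2) by linarith
    qed
  qed
  ultimately have "has_PBD 94 (\<Sum>x\<in>PG n. w x)" by (intro PG_has_PBD) auto
  moreover have "(\<Sum>x\<in>PG n. w x) = sum_list us + 4 * (bracket4 n - 5)"
  proof -
    have "(\<Sum>x\<in>PG n. w x) = (\<Sum>x\<in>PG n - PG 1. w x) + (\<Sum>x\<in>PG 1. w x)"
      by (rule sum.subset_diff[OF PG_mono[OF n] finite_PG])
    also have "(\<Sum>x\<in>PG n - PG 1. w x) = (\<Sum>x\<in>PG n - PG 1. 4)" by (intro sum.cong) (simp_all add: w4)
    also have "(\<Sum>x\<in>PG n - PG 1. 4) = 4 * card (PG n - PG 1)" by simp
    also have "card (PG n - PG 1) = bracket4 n - 5"
      using PG_mono[OF n] finite_PG c1 by (simp add: card_Diff_subset card_PG)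
    finally show ?thesis using sum1 by simp
  qed
  ultimately show ?thesis by (simp add: add.commute)
qed

section \<open>From a hyperplane to the next dimension\<close>

text \<open>If the base point of a line has degree above \<open>n\<close>, so have all its affine
  points, and only the direction is left in the hyperplane \<open>PG n\<close>.\<close>

lemma lines_Suc_cases:
  assumes "l \<in> lines (Suc n)"
  obtains "l \<in> lines n" | z where "z \<in> PG n" "l \<inter> PG n = {z}"
proof -
  obtain x z where xz: "x \<in> PG (Suc n)" "z \<in> PG (Suc n)" "degree z < degree x" "l = pline x z"
    using assms unfolding lines_def by blast
  show ?thesis
  proof (cases "degree x \<le> n")
    case True
    then have "x \<in> PG n" "z \<in> PG n" using xz by (auto simp: PG_def)
    then have "l \<in> lines n" using xz(3,4) unfolding lines_def by blast
    then show ?thesis by (rule that(1))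
  next
    case False
    then have z: "z \<in> PG n" using xz by (auto simp: PG_def)
    have "degree (x + smult a z) > n" for a
      using affine_point_monic(2)[OF xz(1,3)] False by simp
    then have "l \<inter> PG n = {z}"
      unfolding xz(4) pline_def using z by (auto simp: PG_def dest: leD)
    with z show ?thesis by (rule that(2))
  qed
qed

text \<open>Outside the hyperplane all weights are 0, so a line not inside it has at most one point
  of positive weight: types (0,0), (1,0), (0,1).\<close>

lemma total_weight_Suc:
  assumes "total_weight n v"
  shows "total_weight (Suc n) v"
proof -
  obtain T S where W: "weighting n T S" and v: "v = 3 * card T + card S"
    using assms unfolding total_weight_def by blast
  have sub: "T \<subseteq> PG n" "S \<subseteq> PG n" "T \<inter> S = {}" using W by (auto simp: weighting_def)
  have "(card (T \<inter> l), card (S \<inter> l)) \<in> line_types" if "l \<in> lines (Suc n)" for l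
    using that
  proof (cases rule: lines_Suc_cases)
    case 1
    then show ?thesis using W by (simp add: weighting_def)
  next
    case (2 z)
    then have "T \<inter> l = T \<inter> {z}" "S \<inter> l = S \<inter> {z}" using sub by blast+
    then show ?thesis using sub(3) by (auto simp: line_types_def Int_insert_right)
  qed
  then have "weighting (Suc n) T S"
    using sub PG_mono[of n "Suc n"] by (auto simp: weighting_def)
  then show ?thesis unfolding total_weight_def using v by blast
qed

text \<open>Outside the hyperplane all weights are 1, so a line not inside it has four such points
  and its direction: types (0,4), (1,4), (0,5).\<close>

lemma total_weight_add_affine:
  assumes "total_weight n v"
  shows "total_weight (Suc n) (4 ^ Suc n + v)"
proof -
  obtain T S where W: "weighting n T S" and v: "v = 3 * card T + card S"
    using assms unfolding total_weight_def by blast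
  have sub: "T \<subseteq> PG n" "S \<subseteq> PG n" "T \<inter> S = {}" using W by (auto simp: weighting_def)
  define A where "A = PG (Suc n) - PG n"
  have PGS: "PG n \<subseteq> PG (Suc n)" by (rule PG_mono) simp
  have "card A = bracket4 (Suc n) - bracket4 n"
    unfolding A_def using PGS by (simp add: card_Diff_subset finite_PG card_PG)
  then have cA: "card A = 4 ^ Suc n" by (simp add: bracket4_Suc)
  have fin: "finite S" "finite A" using sub finite_PG finite_subset unfolding A_def by blast+
  have "S \<inter> A = {}" using sub by (auto simp: A_def)
  then have cS: "card (S \<union> A) = card S + 4 ^ Suc n" using fin cA by (simp add: card_Un_disjoint)
  have "(card (T \<inter> l), card ((S \<union> A) \<inter> l)) \<in> line_types" if l: "l \<in> lines (Suc n)" for l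
    using l
  proof (cases rule: lines_Suc_cases)
    case 1
    then have "(S \<union> A) \<inter> l = S \<inter> l" using line_subset[OF 1] by (auto simp: A_def)
    then show ?thesis using W 1 by (simp add: weighting_def)
  next
    case (2 z)
    have lS: "l \<subseteq> PG (Suc n)" by (rule line_subset[OF l])
    have T: "T \<inter> l = T \<inter> {z}" using sub 2 by blast
    have S: "(S \<union> A) \<inter> l = (S \<inter> {z}) \<union> (l - {z})"
      using sub 2 lS by (auto simp: A_def)
    have c4: "card (l - {z}) = 4" using card_line[OF l] 2 by (subst card_Diff_singleton) auto
    have fl: "finite (l - {z})" by (rule card_ge_0_finite) (simp add: c4)
    have "card ((S \<inter> {z}) \<union> (l - {z})) = card (S \<inter> {z}) + 4"
      using fl c4 by (subst card_Un_disjoint) auto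
    then show ?thesis unfolding T S using sub(3) by (auto simp: line_types_def Int_insert_right)
  qed
  then have "weighting (Suc n) T (S \<union> A)"
    using sub PGS by (auto simp: weighting_def A_def)
  then show ?thesis unfolding total_weight_def using v cS by (intro exI conjI) (assumption, simp)
qed

section \<open>Totals with at most one point of weight 0\<close>

lemma line_types_full: "a + b = 5 \<Longrightarrow> (a, b) \<in> line_types"
proof -
  assume "a + b = 5"
  then have "a = 0 \<and> b = 5 \<or> a = 1 \<and> b = 4 \<or> a = 2 \<and> b = 3 \<or> a = 3 \<and> b = 2 \<or> a = 4 \<and> b = 1 \<or>
    a = 5 \<and> b = 0" by presburger
  then show ?thesis by (elim disjE) (simp_all add: line_types_def)
qed

lemma card_complementary_line:
  assumes "l \<in> lines n" "T \<inter> S = {}" "l \<subseteq> T \<union> S"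
  shows "card (T \<inter> l) + card (S \<inter> l) = 5"
proof -
  have "finite l" using line_subset[OF assms(1)] finite_PG finite_subset by blast
  then have "card (T \<inter> l) + card (S \<inter> l) = card ((T \<inter> l) \<union> (S \<inter> l))"
    using assms(2) by (subst card_Un_disjoint) auto
  also have "(T \<inter> l) \<union> (S \<inter> l) = l" using assms(3) by blast
  finally show ?thesis using card_line[OF assms(1)] by simp
qed

lemma total_weight_odd:
  assumes "u \<le> bracket4 n"
  shows "total_weight n (bracket4 n + 2 * u)"
proof -
  obtain T where T: "T \<subseteq> PG n" "card T = u"
    using assms by (metis card_PG obtain_subset_with_card_n)
  have "card (T \<inter> l) + card ((PG n - T) \<inter> l) = 5" if "l \<in> lines n" for l
    using card_complementary_line[OF that, of T "PG n - T"] line_subset[OF that] by blast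
  then have "weighting n T (PG n - T)"
    using T(1) line_types_full by (auto simp: weighting_def)
  moreover have "bracket4 n + 2 * u = 3 * card T + card (PG n - T)"
    using T assms finite_subset[OF T(1) finite_PG] by (simp add: card_Diff_subset card_PG)
  ultimately show ?thesis unfolding total_weight_def by blast
qed

text \<open>Being of degree 0, the point \<open>1\<close> is the direction of every line through it;
  such lines correspond to the points \<open>r\<close> of \<open>PG n\<close>.\<close>

lemma line_through_1:
  assumes "l \<in> lines (Suc n)" "1 \<in> l"
  obtains r where "r \<in> PG n" "l = insert 1 (range (\<lambda>a. pCons a r))"
proof -
  obtain x z where xz: "x \<in> PG (Suc n)" "z \<in> PG (Suc n)" "degree z < degree x" "l = pline x z"
    using assms unfolding lines_def by blast
  have "1 \<noteq> x + smult a z" for a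
    using affine_point_monic(2)[OF xz(1,3), of a] xz(3) by auto
  then have z: "z = 1" using assms(2) unfolding xz(4) pline_def by blast
  obtain b r where x: "x = pCons b r" by (cases x) auto
  have "r \<noteq> 0" using xz(3) unfolding x by auto
  then have r: "r \<in> PG n" using xz(1) unfolding x by (simp add: PG_def)
  have eq: "x + smult a z = pCons (b + a) r" for a
    by (simp add: x z one_pCons)
  have "range (\<lambda>a. x + smult a z) = range (\<lambda>a. pCons a r)"
  proof (intro subset_antisym subsetI)
    fix y assume "y \<in> range (\<lambda>a. pCons a r)"
    then obtain a where "y = pCons a r" by blast
    then have "y = x + smult (a - b) z" unfolding eq by simp
    then show "y \<in> range (\<lambda>a. x + smult a z)" by blast
  qed (use eq in blast)
  then have "l = insert 1 (range (\<lambda>a. pCons a r))" unfolding xz(4) pline_def z by simp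
  with r show ?thesis by (rule that)
qed

text \<open>The point \<open>1\<close> gets weight 0. Write u as a sum of \<open>c - i\<close> fours
  and \<open>i\<close> threes: the lines through \<open>1\<close> given by \<open>C\<close> have all
  four other points in \<open>T\<close>, except that those given by \<open>D\<close> leave out the
  point with constant coefficient 0.\<close>

lemma total_weight_even:
  assumes u: "u \<le> 4 * bracket4 n" "u \<notin> {1, 2, 5}"
  shows "total_weight (Suc n) (4 * bracket4 n + 2 * u)"
proof -
  \<comment> \<open>The quotient u / 4 rounded up, so that \<open>i\<close> is at most 3.\<close>
  define c where "c = (u + 3) div 4"
  define i where "i = 4 * c - u"
  have c: "c \<le> bracket4 n" "u \<le> 4 * c" using u(1) unfolding c_def by linarith+
  have c4: "4 * c \<le> u + 3" unfolding c_def by linarith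
  have i: "i \<le> c" "u = 4 * c - i"
  proof -
    show "u = 4 * c - i" using c(2) unfolding i_def by linarith
    show "i \<le> c"
    proof (rule ccontr)
      assume "\<not> i \<le> c"
      \<comment> \<open>From 4c - 3 \<le> u < 3c it follows that c < 3: c = 1 gives u = 1 or 2, and
        c = 2 gives u = 5.\<close>
      then have lt: "u < 3 * c" unfolding i_def by linarith
      then have "c = 1 \<or> c = 2" using c4 by linarith
      then have "u = 1 \<or> u = 2 \<or> u = 5" using lt c4 by presburger
      then show False using u(2) by simp
    qed
  qed
  obtain C where C: "C \<subseteq> PG n" "card C = c"
    using c(1) by (metis card_PG obtain_subset_with_card_n)
  obtain D where D: "D \<subseteq> C" "card D = i" "finite D"
    using i(1) C(2) by (metis obtain_subset_with_card_n)
  define T where "T = (\<lambda>(a, r). pCons a r) ` (UNIV \<times> C) - pCons 0 ` D"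
  define S where "S = PG (Suc n) - {1} - T"
  have T_iff: "pCons a r \<in> T \<longleftrightarrow> r \<in> C \<and> \<not> (a = 0 \<and> r \<in> D)" for a r
    by (auto simp: T_def)
  have "card ((\<lambda>(a, r). pCons a r) ` ((UNIV :: gf4 set) \<times> C)) = 4 * c"
    by (subst card_image) (auto simp: inj_on_def card_cartesian_product card_gf4 C(2))
  moreover have "card (pCons (0 :: gf4) ` D) = i"
    by (subst card_image) (auto simp: inj_on_def D(2))
  moreover have "pCons 0 ` D \<subseteq> (\<lambda>(a, r). pCons a r) ` ((UNIV :: gf4 set) \<times> C)"
    using D(1) by auto
  ultimately have cT: "card T = u"
    unfolding T_def using D(3) i(2) by (simp add: card_Diff_subset)
  have not1: "1 \<notin> T"
    using C(1) PG_nonzero[of 0 n] T_iff[of 1 0] by (auto simp: one_pCons)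
  have Tsub: "T \<subseteq> PG (Suc n)" unfolding T_def PG_Suc using C(1) by auto
  have fT: "finite T" using Tsub finite_PG finite_subset by blast
  have one: "1 \<in> PG (Suc n)" by (simp add: PG_Suc)
  have "card (PG (Suc n) - {1} - T) = card (PG (Suc n) - {1}) - card T"
    using Tsub not1 fT by (intro card_Diff_subset) auto
  then have cS: "card S = 4 * bracket4 n - u"
    using one cT by (simp add: S_def card_Diff_singleton card_PG bracket4_Suc')
  have "(card (T \<inter> l), card (S \<inter> l)) \<in> line_types" if l: "l \<in> lines (Suc n)" for l
  proof (cases "1 \<in> l")
    case False
    then have "l \<subseteq> T \<union> S" using line_subset[OF l] by (auto simp: S_def)
    then show ?thesis
      using card_complementary_line[OF l, of T S] by (intro line_types_full) (auto simp: S_def)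
  next
    case True
    obtain r where r: "r \<in> PG n" "l = insert 1 (range (\<lambda>a. pCons a r))"
      using line_through_1[OF l True] .
    have cr: "card ((\<lambda>a. pCons a r) ` X) = card X" for X :: "gf4 set"
      by (rule card_image) (simp add: inj_on_def)
    have Tl: "T \<inter> l = (\<lambda>a. pCons a r) ` {a. pCons a r \<in> T}"
      unfolding r(2) using not1 by blast
    have "pCons a r \<noteq> 1 \<and> pCons a r \<in> PG (Suc n)" for a
      using r(1) PG_nonzero[of r n] by (auto simp: one_pCons PG_Suc)
    then have "S \<inter> l = (\<lambda>a. pCons a r) ` {a. pCons a r \<notin> T}"
      unfolding r(2) S_def by auto
    then have ct: "card (T \<inter> l) = card {a. pCons a r \<in> T}" "card (S \<inter> l) = card {a. pCons a r \<notin> T}"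
      unfolding Tl by (simp_all only: cr)
    consider "r \<notin> C" | "r \<in> D" | "r \<in> C" "r \<notin> D" by blast
    then show ?thesis
    proof cases
      case 1
      then show ?thesis unfolding ct by (simp add: T_iff line_types_def card_gf4)
    next
      case 2
      then have "{a. pCons a r \<in> T} = UNIV - {0}" "{a. pCons a r \<notin> T} = {0}"
        using D(1) by (auto simp: T_iff)
      then show ?thesis unfolding ct by (simp add: line_types_def card_gf4 card_Diff_singleton)
    next
      case 3
      then show ?thesis unfolding ct by (simp add: T_iff line_types_def card_gf4)
    qed
  qed
  then have "weighting (Suc n) T S" using Tsub by (auto simp: weighting_def S_def)
  moreover have "4 * bracket4 n + 2 * u = 3 * card T + card S" using cT cS u(1) by simp
  ultimately show ?thesis unfolding total_weight_def by blast
qed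

text \<open>The complement of such a set meets no line in exactly two points, so it can carry weight 1.\<close>

definition no_trisecant :: "nat \<Rightarrow> gf4 poly set \<Rightarrow> bool" where
  "no_trisecant n Z \<longleftrightarrow> Z \<subseteq> PG n \<and> (\<forall>l\<in>lines n. card (Z \<inter> l) \<noteq> 3)"

lemma total_weight_complement:
  assumes "no_trisecant n Z"
  shows "total_weight n (bracket4 n - card Z)"
proof -
  have Z: "Z \<subseteq> PG n" using assms by (simp add: no_trisecant_def)
  have "(card ({} \<inter> l), card ((PG n - Z) \<inter> l)) \<in> line_types" if l: "l \<in> lines n" for l
  proof -
    have "card (Z \<inter> l) + card ((PG n - Z) \<inter> l) = 5"
      using card_complementary_line[OF l, of Z "PG n - Z"] line_subset[OF l] by blast
    moreover have "card (Z \<inter> l) \<noteq> 3" using assms l by (simp add: no_trisecant_def)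
    ultimately have "card ((PG n - Z) \<inter> l) \<in> {0, 1, 3, 4, 5}" by auto
    then show ?thesis by (auto simp: line_types_def)
  qed
  then have "weighting n {} (PG n - Z)" by (simp add: weighting_def)
  moreover have "card (PG n - Z) = bracket4 n - card Z"
    using Z finite_subset[OF Z finite_PG] by (simp add: card_Diff_subset card_PG)
  ultimately show ?thesis unfolding total_weight_def by (metis add.left_neutral card.empty mult_0_right)
qed

section \<open>Extending a set without trisecants to higher dimension\<close>

lemma card_pline_Int:
  assumes "x \<in> PG n" "z \<in> PG n" "degree z < degree x"
  shows "card (Z \<inter> pline x z) = (if z \<in> Z then 1 else 0) + card {a. x + smult a z \<in> Z}"
proof -
  have z: "z \<notin> range (\<lambda>a. x + smult a z)" by (rule direction_not_affine[OF assms(1,3)])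
  have "Z \<inter> pline x z = (Z \<inter> {z}) \<union> (\<lambda>a. x + smult a z) ` {a. x + smult a z \<in> Z}"
    unfolding pline_def by blast
  moreover have "(Z \<inter> {z}) \<inter> (\<lambda>a. x + smult a z) ` {a. x + smult a z \<in> Z} = {}"
    using z by blast
  moreover have "card ((\<lambda>a. x + smult a z) ` {a. x + smult a z \<in> Z}) = card {a. x + smult a z \<in> Z}"
    by (rule card_image[OF inj_on_subset[OF inj_affine[OF PG_nonzero[OF assms(2)]] subset_UNIV]])
  ultimately show ?thesis by (simp add: card_Un_disjoint)
qed

lemma affine_root:
  fixes b c d :: gf4
  assumes "c \<noteq> 0"
  shows "{a. b + a * c = d} = {(d - b) / c}"
  using assms by (simp add: set_eq_iff nonzero_eq_divide_eq eq_diff_eq add.commute)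

text \<open>The new points are those of the hyperplane where the coefficient of degree m vanishes;
  this hyperplane meets \<^term>\<open>PG m\<close> in \<^term>\<open>PG (m - 1)\<close>.\<close>

lemma no_trisecant_extend:
  assumes Z: "no_trisecant m Z" and mn: "m \<le> n"
  defines "Y \<equiv> {p \<in> PG n. m < degree p \<and> coeff p m = 0}"
  shows "no_trisecant n (Y \<union> Z)" "Y \<inter> Z = {}" "4 * card Y = bracket4 n - bracket4 m"
proof -
  have Zm: "Z \<subseteq> PG m" using Z by (simp add: no_trisecant_def)
  have Zdeg: "degree p \<le> m" if "p \<in> Z" for p using Zm that by (auto simp: PG_def)
  show disj: "Y \<inter> Z = {}" unfolding Y_def using Zdeg leD by blast
  have "card ((Y \<union> Z) \<inter> pline x z) \<noteq> 3"
    if xz: "x \<in> PG n" "z \<in> PG n" "degree z < degree x" for x z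
  proof (cases "degree x \<le> m")
    case True
    then have "x \<in> PG m" "z \<in> PG m" using xz by (auto simp: PG_def)
    then have "pline x z \<in> lines m" using xz(3) unfolding lines_def by blast
    moreover have "Y \<inter> PG m = {}" by (auto simp: Y_def PG_def)
    then have "(Y \<union> Z) \<inter> pline x z = Z \<inter> pline x z"
      using line_subset[OF \<open>pline x z \<in> lines m\<close>] by blast
    ultimately show ?thesis using Z by (simp add: no_trisecant_def)
  next
    case False
    have deg: "degree (x + smult a z) = degree x" "x + smult a z \<in> PG n" for a
      using affine_point_monic[OF xz(1,3)] by auto
    \<comment> \<open>Membership of an affine point is one linear condition on \<open>a\<close>,
      with 0, 1 or 4 solutions. The direction adds at most one, so the count is never 3, whatever
      \<open>Z\<close> looks like.\<close>
    have mem: "x + smult a z \<in> Y \<union> Z \<longleftrightarrow> coeff x m + a * coeff z m = 0" for a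
      using Zdeg[of "x + smult a z"] deg[of a] False by (auto simp: Y_def)
    show ?thesis
    proof (cases "coeff z m = 0")
      case True
      then have "card {a. x + smult a z \<in> Y \<union> Z} \<in> {0, 4}"
        unfolding mem by (cases "coeff x m = 0") (simp_all add: card_gf4)
      then show ?thesis unfolding card_pline_Int[OF xz] by auto
    next
      case False
      then have "card {a. x + smult a z \<in> Y \<union> Z} = 1"
        unfolding mem affine_root[OF False] by simp
      then show ?thesis unfolding card_pline_Int[OF xz] by simp
    qed
  qed
  moreover have "Y \<union> Z \<subseteq> PG n" using Zm PG_mono[OF mn] by (auto simp: Y_def)
  ultimately show "no_trisecant n (Y \<union> Z)" by (auto simp: no_trisecant_def lines_def)
  \<comment> \<open>Changing the coefficient of degree \<open>m\<close> freely shows that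
    \<open>PG n - PG m\<close> consists of four translates of \<open>Y\<close>.\<close>
  define f where "f = (\<lambda>(a :: gf4, p). p + monom a m)"
  have deg_f: "degree (p + monom a m) = degree p \<and> lead_coeff (p + monom a m) = lead_coeff p"
    if "m < degree p" for p :: "gf4 poly" and a
  proof -
    have "degree (monom a m) < degree p" using that degree_monom_le[of a m] by linarith
    then have "degree (p + monom a m) = degree p" by (rule degree_add_eq_left)
    then show ?thesis using that by simp
  qed
  have "f ` (UNIV \<times> Y) = PG n - PG m"
  proof (intro subset_antisym subsetI)
    fix y assume "y \<in> f ` (UNIV \<times> Y)"
    then obtain a p where "p \<in> Y" "y = p + monom a m" by (auto simp: f_def)
    then show "y \<in> PG n - PG m" using deg_f[of p a] by (simp add: Y_def PG_def)
  next
    fix y assume "y \<in> PG n - PG m"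
    then have y: "y \<in> PG n" "m < degree y" by (auto simp: PG_def)
    let ?p = "y + monom (- coeff y m) m"
    have "?p \<in> Y" using y deg_f[OF y(2), of "- coeff y m"] by (simp add: Y_def PG_def)
    moreover have "y = f (coeff y m, ?p)" by (simp add: f_def add.assoc add_monom)
    ultimately show "y \<in> f ` (UNIV \<times> Y)" by blast
  qed
  moreover have "inj_on f (UNIV \<times> Y)"
  proof (rule inj_onI)
    fix s t assume st: "s \<in> UNIV \<times> Y" "t \<in> UNIV \<times> Y" "f s = f t"
    obtain a p b q where ab: "s = (a, p)" "t = (b, q)" by (cases s; cases t)
    have eq: "p + monom a m = q + monom b m" using st(3) by (simp add: f_def ab)
    have "coeff p m = 0" "coeff q m = 0" using st(1,2) by (auto simp: ab Y_def)
    then have "a = b" using arg_cong[OF eq, of "\<lambda>p. coeff p m"] by simp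
    then show "s = t" using eq by (simp add: ab)
  qed
  ultimately have "card (UNIV \<times> Y :: (gf4 \<times> gf4 poly) set) = card (PG n - PG m)"
    using card_image by metis
  then show "4 * card Y = bracket4 n - bracket4 m"
    using PG_mono[OF mn] by (simp add: card_cartesian_product card_gf4 card_Diff_subset finite_PG card_PG)
qed

section \<open>Sets without trisecants\<close>

text \<open>The vector space GF(4)^j. A bound by \<open>degree p < j\<close> would make it empty for
  j = 0, where it has to be the single point 0.\<close>

definition polys_below :: "nat \<Rightarrow> gf4 poly set" where
  "polys_below j = {p. \<forall>i\<ge>j. coeff p i = 0}"

definition affine_no_trisecant :: "nat \<Rightarrow> gf4 poly set \<Rightarrow> bool" where
  "affine_no_trisecant j A \<longleftrightarrow> A \<subseteq> polys_below j \<and>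
     (\<forall>r\<in>polys_below j. \<forall>z\<in>polys_below j. z \<noteq> 0 \<longrightarrow> card {a. r + smult a z \<in> A} \<noteq> 3)"

lemma polys_below_0: "polys_below 0 = {0}"
  by (auto simp: polys_below_def poly_eq_iff)

lemma pCons_polys_below: "pCons a r \<in> polys_below (Suc j) \<longleftrightarrow> r \<in> polys_below j"
  unfolding polys_below_def mem_Collect_eq
proof (intro iffI allI impI)
  fix i assume "\<forall>i\<ge>Suc j. coeff (pCons a r) i = 0" "j \<le> i"
  then have "coeff (pCons a r) (Suc i) = 0" by blast
  then show "coeff r i = 0" by simp
next
  fix i assume "\<forall>i\<ge>j. coeff r i = 0" "Suc j \<le> i"
  then show "coeff (pCons a r) i = 0" by (cases i) auto
qed

lemma polys_below_Suc:
  "polys_below (Suc j) = (\<lambda>(a, r). pCons a r) ` (UNIV \<times> polys_below j)"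
proof (intro subset_antisym subsetI)
  fix p assume p: "p \<in> polys_below (Suc j)"
  obtain a r where ar: "p = pCons a r" by (cases p) auto
  then have "r \<in> polys_below j" using p pCons_polys_below by simp
  then show "p \<in> (\<lambda>(a, r). pCons a r) ` (UNIV \<times> polys_below j)" unfolding ar by blast
next
  fix p assume "p \<in> (\<lambda>(a, r). pCons a r) ` (UNIV \<times> polys_below j)"
  then show "p \<in> polys_below (Suc j)" by (auto simp: pCons_polys_below)
qed

lemma card_polys_below: "finite (polys_below j) \<and> card (polys_below j) = 4 ^ j"
proof (induction j)
  case (Suc j)
  have "inj_on (\<lambda>(a :: gf4, r). pCons a r) (UNIV \<times> polys_below j)" by (auto simp: inj_on_def)
  then show ?case
    unfolding polys_below_Suc using Suc
    by (simp add: card_image card_cartesian_product card_gf4)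
qed (simp add: polys_below_0)

lemma polys_below_combine:
  "r \<in> polys_below j \<Longrightarrow> z \<in> polys_below j \<Longrightarrow> r + smult a z \<in> polys_below j"
  by (simp add: polys_below_def)

lemma affine_no_trisecant_full: "affine_no_trisecant j (polys_below j)"
proof -
  have "{a. r + smult a z \<in> polys_below j} = UNIV" if "r \<in> polys_below j" "z \<in> polys_below j" for r z
    using polys_below_combine[OF that] by blast
  then show ?thesis by (simp add: affine_no_trisecant_def card_gf4)
qed

lemma affine_no_trisecant_empty: "affine_no_trisecant j {}"
  by (simp add: affine_no_trisecant_def)

text \<open>The two sets lie in parallel hyperplanes. A line parallel to these is contained in one
  of them or misses both; any other line meets each of them once, hence the union at most
  twice.\<close>

lemma affine_no_trisecant_parallel:
  assumes A: "affine_no_trisecant j A" and B: "affine_no_trisecant j B"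
  shows "affine_no_trisecant (Suc j) (pCons 0 ` A \<union> pCons 1 ` B)"
    and "card (pCons 0 ` A \<union> pCons 1 ` B) = card A + card B"
proof -
  let ?C = "pCons 0 ` A \<union> pCons 1 ` B"
  have sub: "A \<subseteq> polys_below j" "B \<subseteq> polys_below j"
    using A B by (auto simp: affine_no_trisecant_def)
  have fin: "finite A" "finite B" using sub card_polys_below finite_subset by blast+
  have "card (pCons 0 ` A \<union> pCons 1 ` B) = card (pCons 0 ` A) + card (pCons (1 :: gf4) ` B)"
    using fin by (intro card_Un_disjoint) auto
  also have "\<dots> = card A + card B" by (simp add: card_image inj_on_def)
  finally show "card ?C = card A + card B" .
  have "card {a. r + smult a z \<in> ?C} \<noteq> 3"
    if rz: "r \<in> polys_below (Suc j)" "z \<in> polys_below (Suc j)" "z \<noteq> 0" for r z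
  proof -
    obtain b s where r: "r = pCons b s" by (cases r) auto
    obtain c y where z: "z = pCons c y" by (cases z) auto
    have sy: "s \<in> polys_below j" "y \<in> polys_below j"
      using rz unfolding r z pCons_polys_below by auto
    have mem: "r + smult a z \<in> ?C \<longleftrightarrow>
        (b + a * c = 0 \<and> s + smult a y \<in> A) \<or> (b + a * c = 1 \<and> s + smult a y \<in> B)" for a
      by (auto simp: r z)
    show ?thesis
    proof (cases "c = 0")
      case True
      then have "y \<noteq> 0" using rz(3) z by simp
      then have "card {a. s + smult a y \<in> A} \<noteq> 3" "card {a. s + smult a y \<in> B} \<noteq> 3"
        using A B sy by (simp_all add: affine_no_trisecant_def)
      then show ?thesis unfolding mem using True
        by (cases "b = 0"; cases "b = 1") simp_all
    next
      case False
      have "{a. r + smult a z \<in> ?C} \<subseteq> {a. b + a * c = 0} \<union> {a. b + a * c = 1}"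
        unfolding mem by blast
      also have "\<dots> = {(0 - b) / c, (1 - b) / c}"
        unfolding affine_root[OF False] by blast
      finally have "card {a. r + smult a z \<in> ?C} \<le> card {(0 - b) / c, (1 - b) / c}"
        by (rule card_mono[rotated]) simp
      also have "\<dots> \<le> 2" by (simp add: card_insert_if)
      finally show ?thesis by simp
    qed
  qed
  moreover have "?C \<subseteq> polys_below (Suc j)" using sub by (auto simp: pCons_polys_below)
  ultimately show "affine_no_trisecant (Suc j) ?C" unfolding affine_no_trisecant_def by blast
qed

text \<open>Base 4 expansion: at most three of the sets are full, and the remaining amount, less than
  \<^term>\<open>4 ^ j\<close>, is distributed over the other three, which offer two parallel classes each.\<close>

lemma six_affine_sets:
  "M < 4 ^ Suc j \<Longrightarrow>
    \<exists>A. (\<forall>i<6::nat. affine_no_trisecant j (A i)) \<and> (\<Sum>i<6. card (A i)) = M"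
proof (induction j arbitrary: M)
  case 0
  define A where "A i = (if i < M then polys_below 0 else {})" for i :: nat
  have "(\<Sum>i<6. card (A i)) = M"
    using 0 by (auto simp: A_def polys_below_0 numeral_eq_Suc lessThan_Suc)
  then show ?case
    using affine_no_trisecant_full[of 0] affine_no_trisecant_empty[of 0]
    by (intro exI[of _ A]) (simp add: A_def)
next
  case (Suc j)
  define q where "q = M div 4 ^ Suc j"
  have M: "M = q * 4 ^ Suc j + M mod 4 ^ Suc j" unfolding q_def by (rule div_mult_mod_eq[symmetric])
  have q: "q < 4" using Suc.prems unfolding q_def by (simp add: less_mult_imp_div_less)
  have "M mod 4 ^ Suc j < 4 ^ Suc j" by simp
  then obtain B :: "nat \<Rightarrow> gf4 poly set" where B: "\<And>i. i < 6 \<Longrightarrow> affine_no_trisecant j (B i)"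
    "(\<Sum>i<6. card (B i)) = M mod 4 ^ Suc j" using Suc.IH by blast
  \<comment> \<open>As \<open>q\<close> is at most 3, the full sets fit into the places 3, 4,
    5.\<close>
  define A where "A i = (if i < 3 then pCons 0 ` B (2 * i) \<union> pCons 1 ` B (2 * i + 1)
    else if i < 3 + q then polys_below (Suc j) else {})" for i :: nat
  have par: "affine_no_trisecant (Suc j) (pCons 0 ` B (2 * i) \<union> pCons 1 ` B (2 * i + 1)) \<and>
      card (pCons 0 ` B (2 * i) \<union> pCons 1 ` B (2 * i + 1)) = card (B (2 * i)) + card (B (2 * i + 1))"
    if "i < 3" for i
    using affine_no_trisecant_parallel[OF B(1) B(1), of "2 * i" "2 * i + 1"] that by simp
  have "affine_no_trisecant (Suc j) (A i)" if "i < 6" for i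
    unfolding A_def using par affine_no_trisecant_full affine_no_trisecant_empty by simp
  moreover have "(\<Sum>i<6. card (A i)) = M"
  proof -
    have six: "(\<Sum>i<6. g i) = g 0 + g 1 + g 2 + g 3 + g 4 + g 5" for g :: "nat \<Rightarrow> nat"
      by (simp add: numeral_eq_Suc)
    have cA: "card (A 0) = card (B 0) + card (B 1)" "card (A 1) = card (B 2) + card (B 3)"
      "card (A 2) = card (B 4) + card (B 5)"
      using par[of 0] par[of 1] par[of 2] by (simp_all add: A_def)
    have "card (A 3) + card (A 4) + card (A 5) = q * 4 ^ Suc j"
    proof -
      have "q = 0 \<or> q = 1 \<or> q = 2 \<or> q = 3" using q by linarith
      then show ?thesis
        using card_polys_below[of "Suc j"] by (elim disjE) (simp_all add: A_def)
    qed
    then show ?thesis using M B(2) cA unfolding six by linarith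
  qed
  ultimately show ?case by blast
qed

text \<open>The conic X^2 + tX + t^2, 1, together with its nucleus X.\<close>

definition hyperoval :: "gf4 poly list" where
  "hyperoval = [[:Zero, Zero, One:], [:One, One, One:], [:Om2, Om, One:], [:Om, Om2, One:],
     [:One:], [:Zero, One:]]"

lemma gf4_consts: "(0 :: gf4) = Zero" "(1 :: gf4) = One"
  by (simp_all add: zero_gf4_def one_gf4_def)

section \<open>The hyperoval in PG(2,4)\<close>

lemma distinct_hyperoval: "distinct hyperoval" "0 \<notin> set hyperoval"
  by (simp_all add: hyperoval_def gf4_consts)

lemma monic_degree_le_2:
  assumes "p \<in> PG 2"
  obtains "p = 1" | c where "p = [:c, 1:]" | c b where "p = [:c, b, 1:]"
proof -
  have "PG 2 = PG (Suc (Suc 0))" by (simp add: numeral_2_eq_2)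
  then have "p = 1 \<or> (\<exists>c. p = [:c, 1:]) \<or> (\<exists>c b. p = [:c, b, 1:])"
    using assms by (auto simp: PG_Suc PG_0 one_pCons)
  then show ?thesis using that by blast
qed

lemma card_Collect_gf4:
  "card {a :: gf4. P a} = of_bool (P Zero) + of_bool (P One) + of_bool (P Om) + of_bool (P Om2)"
proof -
  have "card {a. P a} = (\<Sum>a\<in>UNIV. of_bool (P a))" by (simp add: of_bool_def sum.If_cases)
  then show ?thesis by (simp add: UNIV_gf4)
qed

lemma hyperoval_line:
  assumes "x \<in> PG 2" "z \<in> PG 2" "degree z < degree x"
  shows "card (set hyperoval \<inter> pline x z) \<le> 2"
  unfolding card_pline_Int[OF assms]
  using assms(1)
proof (cases rule: monic_degree_le_2)
  case 1
  then show "(if z \<in> set hyperoval then 1 else 0) + card {a. x + smult a z \<in> set hyperoval} \<le> 2"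
    using assms(3) by simp
next
  case (2 c)
  have "z = 1" using assms(2)
  proof (cases rule: monic_degree_le_2)
  qed (use assms(3) 2 in auto)
  then show "(if z \<in> set hyperoval then 1 else 0) + card {a. x + smult a z \<in> set hyperoval} \<le> 2"
    unfolding 2 card_Collect_gf4
    by (cases c) (simp_all add: hyperoval_def gf4_consts one_pCons)
next
  case (3 c b)
  from assms(2) consider "z = 1" | e where "z = [:e, 1:]"
  proof (cases rule: monic_degree_le_2)
  qed (use assms(3) 3 in auto)
  then show "(if z \<in> set hyperoval then 1 else 0) + card {a. x + smult a z \<in> set hyperoval} \<le> 2"
  proof cases
    case 1
    then show ?thesis
      unfolding 3 card_Collect_gf4
      by (cases c; cases b) (simp_all add: hyperoval_def gf4_consts one_pCons)
  next
    case (2 e)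
    then show ?thesis
      unfolding 3 card_Collect_gf4
      by (cases c; cases b; cases e) (simp_all add: hyperoval_def gf4_consts)
  qed
qed

section \<open>Cones over the hyperoval\<close>

text \<open>\<open>poly_shift j\<close> is the projection from the vertex of the cone, the points of
  degree below \<open>j\<close>, and \<open>poly_cutoff j\<close> is the coordinate inside a fibre.
  Both are linear, so lines can be followed through them.\<close>

lemma poly_shift_affine:
  "poly_shift j (x + smult a z) = poly_shift j x + smult a (poly_shift j (z :: gf4 poly))"
  by (simp add: poly_eq_iff coeff_poly_shift)

lemma poly_cutoff_affine:
  "poly_cutoff j (x + smult a z) = poly_cutoff j x + smult a (poly_cutoff j (z :: gf4 poly))"
  by (simp add: poly_eq_iff coeff_poly_cutoff)

lemma poly_cutoff_below: "poly_cutoff j p \<in> polys_below j"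
  by (simp add: polys_below_def coeff_poly_cutoff)

text \<open>Outside the vertex the projection keeps leading coefficients and lowers all degrees by
  \<open>j\<close>, so normalised points go to normalised points and directions to
  directions.\<close>

lemma degree_poly_shift:
  fixes p :: "gf4 poly"
  assumes "poly_shift j p \<noteq> 0"
  shows "degree p = j + degree (poly_shift j p)" "lead_coeff (poly_shift j p) = lead_coeff p"
proof -
  let ?h = "poly_shift j p"
  have c: "coeff p (i + j) = coeff ?h i" for i by (simp add: coeff_poly_shift)
  have "coeff p (degree ?h + j) \<noteq> 0" unfolding c using assms by simp
  then have "degree ?h + j \<le> degree p" by (rule le_degree)
  moreover have "degree p \<le> degree ?h + j"
  proof (rule degree_le, intro allI impI)
    fix i assume i: "degree ?h + j < i"
    then have "coeff ?h (i - j) = 0" by (intro coeff_eq_0) simp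
    then show "coeff p i = 0" using c[of "i - j"] i by simp
  qed
  ultimately show d: "degree p = j + degree ?h" by simp
  show "lead_coeff ?h = lead_coeff p" using c[of "degree ?h"] by (simp add: d add.commute)
qed

text \<open>A cone with vertex \<^term>\<open>PG (j - 1)\<close> over the hyperoval, with the vertex removed
  and each of its six affine fibres thinned out.\<close>

lemma no_trisecant_exists:
  assumes "M < 4 ^ Suc j"
  shows "\<exists>Z. no_trisecant (j + 2) Z \<and> card Z = M"
proof -
  obtain A :: "nat \<Rightarrow> gf4 poly set" where A: "\<And>i. i < 6 \<Longrightarrow> affine_no_trisecant j (A i)"
    and M: "(\<Sum>i<6. card (A i)) = M" using six_affine_sets[OF assms] by blast
  have A_sub: "A i \<subseteq> polys_below j" if "i < 6" for i
    using A[OF that] by (simp add: affine_no_trisecant_def)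
  have A_fin: "finite (A i)" if "i < 6" for i
    using A_sub[OF that] card_polys_below finite_subset by blast
  define h where "h i = hyperoval ! i" for i
  have len: "length hyperoval = 6" by (simp add: hyperoval_def)
  have h_inj: "i = k" if "i < 6" "k < 6" "h i = h k" for i k
    using that distinct_hyperoval(1) len by (simp add: h_def nth_eq_iff_index_eq)
  have h_mem: "h i \<in> set hyperoval" if "i < 6" for i using that len by (simp add: h_def)
  have h_PG: "h i \<in> PG 2" if "i < 6" for i
    using h_mem[OF that] by (auto simp: hyperoval_def PG_def gf4_consts)
  define Z where "Z = {p. \<exists>i<6. poly_shift j p = h i \<and> poly_cutoff j p \<in> A i}"
  define f where "f = (\<lambda>(i, r). monom 1 j * h i + r)"
  have shift_f: "poly_shift j (monom 1 j * q + r) = q" "poly_cutoff j (monom 1 j * q + r) = r"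
    if "r \<in> polys_below j" for q r
    using that by (auto simp: poly_eq_iff coeff_poly_shift coeff_poly_cutoff coeff_monom_mult polys_below_def)
  have split: "p = monom 1 j * poly_shift j p + poly_cutoff j p" for p :: "gf4 poly"
    by (simp add: poly_eq_iff coeff_poly_shift coeff_poly_cutoff coeff_monom_mult)
  have "f ` Sigma {..<6} A = Z"
  proof (intro subset_antisym subsetI)
    fix p assume "p \<in> f ` Sigma {..<6} A"
    then obtain i r where ir: "i < 6" "r \<in> A i" "p = monom 1 j * h i + r" by (auto simp: f_def)
    then have "r \<in> polys_below j" using A_sub[of i] by blast
    then have "poly_shift j p = h i" "poly_cutoff j p = r"
      unfolding ir(3) by (simp_all only: shift_f)
    then show "p \<in> Z" unfolding Z_def using ir(1,2) by blast
  next
    fix p assume "p \<in> Z"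
    then obtain i where i: "i < 6" "poly_shift j p = h i" "poly_cutoff j p \<in> A i"
      unfolding Z_def by blast
    then have "p = f (i, poly_cutoff j p)" using split[of p] by (simp add: f_def)
    moreover have "(i, poly_cutoff j p) \<in> Sigma {..<6} A" using i by simp
    ultimately show "p \<in> f ` Sigma {..<6} A" by (rule image_eqI)
  qed
  moreover have "inj_on f (Sigma {..<6} A)"
  proof (rule inj_onI)
    fix s t assume st: "s \<in> Sigma {..<6} A" "t \<in> Sigma {..<6} A" "f s = f t"
    obtain i r where s: "s = (i, r)" by (cases s)
    obtain k u where t: "t = (k, u)" by (cases t)
    have b: "i < 6" "k < 6" "r \<in> polys_below j" "u \<in> polys_below j"
      using st(1,2) A_sub[of i] A_sub[of k] unfolding s t by auto
    have eq: "monom 1 j * h i + r = monom 1 j * h k + u" using st(3) by (simp add: f_def s t)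
    have "h i = h k" using arg_cong[OF eq, of "poly_shift j"] by (simp only: shift_f[OF b(3)] shift_f[OF b(4)])
    moreover have "r = u" using arg_cong[OF eq, of "poly_cutoff j"] by (simp only: shift_f[OF b(3)] shift_f[OF b(4)])
    ultimately show "s = t" using h_inj[OF b(1,2)] unfolding s t by simp
  qed
  ultimately have "card Z = card (Sigma {..<6} A)" using card_image by metis
  also have "\<dots> = M" using A_fin M by (subst card_SigmaI) auto
  finally have cZ: "card Z = M" .
  have Z_PG: "Z \<subseteq> PG (j + 2)"
  proof
    fix p assume "p \<in> Z"
    then obtain i where "i < 6" "poly_shift j p = h i" unfolding Z_def by blast
    then have "poly_shift j p \<in> PG 2" using h_PG by simp
    then show "p \<in> PG (j + 2)"
      using degree_poly_shift[of j p] PG_nonzero by (auto simp: PG_def)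
  qed
  have "card (Z \<inter> pline x z) \<noteq> 3"
    if xz: "x \<in> PG (j + 2)" "z \<in> PG (j + 2)" "degree z < degree x" for x z
  \<comment> \<open>A direction in the vertex is killed by the projection: the affine points of the
    line stay in one fibre, where \<open>A i\<close> decides. Any other line projects bijectively
    onto a line of the plane, which meets the hyperoval at most twice.\<close>
  proof (cases "poly_shift j z = 0")
    case True
    have "poly_cutoff j z \<noteq> 0" using split[of z] True PG_nonzero[OF xz(2)] by auto
    \<comment> \<open>The vertex is not in \<open>Z\<close>; otherwise the direction could raise a
      count of two to three.\<close>
    have zZ: "z \<notin> Z" using True h_mem distinct_hyperoval(2) unfolding Z_def by fastforce
    show ?thesis
    proof (cases "\<exists>i<6. poly_shift j x = h i")
      case True': True
      then obtain i where i: "i < 6" "poly_shift j x = h i" by blast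
      have "x + smult a z \<in> Z \<longleftrightarrow> poly_cutoff j x + smult a (poly_cutoff j z) \<in> A i" for a
        unfolding Z_def using i h_inj by (auto simp: poly_shift_affine poly_cutoff_affine True)
      moreover have "card {a. poly_cutoff j x + smult a (poly_cutoff j z) \<in> A i} \<noteq> 3"
        using A[OF i(1)] \<open>poly_cutoff j z \<noteq> 0\<close> poly_cutoff_below by (auto simp: affine_no_trisecant_def)
      ultimately show ?thesis using zZ by (simp add: card_pline_Int[OF xz])
    next
      case False
      then have "x + smult a z \<notin> Z" for a
        unfolding Z_def by (auto simp: poly_shift_affine True)
      then show ?thesis using zZ by (simp add: card_pline_Int[OF xz])
    qed
  next
    case False
    let ?x = "poly_shift j x" and ?z = "poly_shift j z"
    have dz: "degree z = j + degree ?z" "lead_coeff ?z = lead_coeff z"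
      using degree_poly_shift[OF False] by auto
    have "coeff ?x (degree x - j) = 1"
      using xz(1,3) dz(1) by (simp add: coeff_poly_shift PG_def)
    then have "?x \<noteq> 0" by auto
    then have dx: "degree x = j + degree ?x" "lead_coeff ?x = lead_coeff x"
      using degree_poly_shift[of j x] by auto
    have S: "?x \<in> PG 2" "?z \<in> PG 2" "degree ?z < degree ?x"
      using xz dx dz by (auto simp: PG_def)
    have "p \<in> Z \<Longrightarrow> poly_shift j p \<in> set hyperoval" for p
      unfolding Z_def using h_mem by auto
    then have "{a. x + smult a z \<in> Z} \<subseteq> {a. ?x + smult a ?z \<in> set hyperoval}"
      and zz: "z \<in> Z \<Longrightarrow> ?z \<in> set hyperoval"
      unfolding poly_shift_affine[symmetric] by blast+
    then have "card {a. x + smult a z \<in> Z} \<le> card {a. ?x + smult a ?z \<in> set hyperoval}"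
      by (intro card_mono) simp_all
    then have "card (Z \<inter> pline x z) \<le> card (set hyperoval \<inter> pline ?x ?z)"
      unfolding card_pline_Int[OF xz] card_pline_Int[OF S] using zz by auto
    then show ?thesis using hyperoval_line[OF S] by linarith
  qed
  then have "no_trisecant (j + 2) Z"
    using Z_PG unfolding no_trisecant_def lines_def by blast
  then show ?thesis using cZ by blast
qed

text \<open>Two lines through the point X^2, with directions X and 1, both directions removed. Each
  keeps four points, together 4 + 4 - 1 = 7; any other line meets each of them at most once.\<close>

lemma no_trisecant_7: "\<exists>Z. no_trisecant 2 Z \<and> card Z = 7"
proof -
  let ?Z = "insert [:0, 0, 1:] ((\<lambda>a. [:0, a, 1:]) ` {One, Om, Om2} \<union> (\<lambda>a. [:a, 0, 1:]) ` {One, Om, Om2}) :: gf4 poly set"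
  have "card (?Z \<inter> pline x z) \<noteq> 3"
    if xz: "x \<in> PG 2" "z \<in> PG 2" "degree z < degree x" for x z
    unfolding card_pline_Int[OF xz]
    using xz(1)
  proof (cases rule: monic_degree_le_2)
    case 1
    then show "(if z \<in> ?Z then 1 else 0) + card {a. x + smult a z \<in> ?Z} \<noteq> 3" using xz(3) by simp
  next
    case (2 c)
    have z: "z = 1" using xz(2)
    proof (cases rule: monic_degree_le_2)
    qed (use xz(3) 2 in auto)
    show "(if z \<in> ?Z then 1 else 0) + card {a. x + smult a z \<in> ?Z} \<noteq> 3"
      unfolding 2 z card_Collect_gf4 by (cases c) (simp_all add: gf4_consts one_pCons)
  next
    case (3 c b)
    from xz(2) consider "z = 1" | e where "z = [:e, 1:]"
    proof (cases rule: monic_degree_le_2)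
    qed (use xz(3) 3 in auto)
    then show "(if z \<in> ?Z then 1 else 0) + card {a. x + smult a z \<in> ?Z} \<noteq> 3"
    proof cases
      case 1
      then show ?thesis
        unfolding 3 card_Collect_gf4
        by (cases c; cases b) (simp_all add: gf4_consts one_pCons)
    next
      case (2 e)
      then show ?thesis
        unfolding 3 card_Collect_gf4
        by (cases c; cases b; cases e) (simp_all add: gf4_consts)
    qed
  qed
  then have "no_trisecant 2 ?Z"
    unfolding no_trisecant_def lines_def by (auto simp: PG_def)
  moreover have "card ?Z = 7" by (simp add: gf4_consts card_insert_if)
  ultimately show ?thesis by blast
qed

section \<open>Totals close to 4^n\<close>

text \<open>The extension adds ([n] - [m]) / 4 = [n-1] - [m-1] points, and [n] - [n-1] = 4^n;
  subtracting \<open>card Z\<close> as well gives the size of the complement.\<close>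

lemma total_weight_extend:
  assumes Z: "no_trisecant m Z" and mn: "1 \<le> m" "m \<le> n"
  shows "total_weight n (4 ^ n + bracket4 (m - 1) - card Z)"
proof -
  obtain m' where m': "m = Suc m'" using mn(1) by (cases m) auto
  obtain n' where n': "n = Suc n'" using mn by (cases n) auto
  define Y where "Y = {p \<in> PG n. m < degree p \<and> coeff p m = 0}"
  note ext = no_trisecant_extend[OF Z mn(2), folded Y_def]
  have "Z \<subseteq> PG m" using Z by (simp add: no_trisecant_def)
  then have fin: "finite Z" "finite Y" using finite_PG finite_subset unfolding Y_def by (blast, simp)
  have "4 * card Y = 4 * (bracket4 n' - bracket4 m')"
    using ext(3) unfolding m' n' bracket4_Suc' by simp
  then have cY: "card Y = bracket4 n' - bracket4 m'" by simp
  have "m' \<le> n'" using mn m' n' by simp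
  then have le: "bracket4 m' \<le> bracket4 n'"
    using card_mono[OF finite_PG PG_mono, of m' n'] by (simp add: card_PG)
  have "card (Y \<union> Z) = card Y + card Z" using fin ext(2) by (simp add: card_Un_disjoint)
  then have "bracket4 n - card (Y \<union> Z) = 4 ^ n + bracket4 (m - 1) - card Z"
    using le unfolding cY n' m' bracket4_Suc by simp
  then show ?thesis using total_weight_complement[OF ext(1)] by simp
qed

text \<open>Take m = k + 2 and a set of 4^(k+1) - d points, and use [k+1] - 4^(k+1) = [k]. The
  strict bound in \<open>no_trisecant_exists\<close> is what asks for d > 0.\<close>

lemma total_weight_gap:
  assumes "k + 2 \<le> n" "0 < d" "d \<le> 4 ^ Suc k"
  shows "total_weight n (4 ^ n + bracket4 k + d)"
proof -
  obtain Z where Z: "no_trisecant (k + 2) Z" "card Z = 4 ^ Suc k - d"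
    using no_trisecant_exists[of "4 ^ Suc k - d" k] assms(2) by auto
  have "total_weight n (4 ^ n + bracket4 (k + 2 - 1) - card Z)"
    by (rule total_weight_extend[OF Z(1)]) (use assms in simp_all)
  moreover have "4 ^ n + bracket4 (k + 2 - 1) - card Z = 4 ^ n + bracket4 k + d"
    using assms(3) unfolding Z(2) by (simp add: bracket4_Suc)
  ultimately show ?thesis by simp
qed

text \<open>With m = 2 the total is 4^n + [1] - 7, where [1] = 5. It equals 3[n-1] - 1, the value
  that the previous dimension cannot give.\<close>

lemma total_weight_minus_2:
  assumes "2 \<le> n"
  shows "total_weight n (4 ^ n - 2)"
proof -
  obtain Z where Z: "no_trisecant 2 Z" "card Z = 7" using no_trisecant_7 by blast
  have "total_weight n (4 ^ n + bracket4 (2 - 1) - card Z)"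
    by (rule total_weight_extend[OF Z(1)]) (use assms in simp_all)
  then show ?thesis unfolding Z(2) by (simp add: bracket4_def)
qed

section \<open>The spectrum\<close>

lemma total_weight_0: "v \<in> {0, 1, 3} \<Longrightarrow> total_weight 0 v"
proof -
  assume v: "v \<in> {0, 1, 3}"
  have no: "lines 0 = {}" by (auto simp: lines_def PG_def)
  have "weighting 0 {} {}" "weighting 0 {} {1}" "weighting 0 {1} {}"
    by (simp_all add: weighting_def no PG_0)
  then show ?thesis using v unfolding total_weight_def by fastforce
qed

text \<open>The numbers 4 = [0] + 3 = [1] - 1 and 10 = [0] + 9 = 2[1] are not exceptional.\<close>

definition exceptional :: "nat set" where
  "exceptional = {bracket4 k + d | k d. d \<in> {1, 3, 9}} - {4, 10}"

lemma exceptionalI: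
  "d \<in> {1, 3, 9} \<Longrightarrow> v = bracket4 k + d \<Longrightarrow> v \<noteq> 4 \<Longrightarrow> v \<noteq> 10 \<Longrightarrow> v \<in> exceptional"
  unfolding exceptional_def by blast

lemma bracket4_ge: "bracket4 k \<ge> 1" "k \<ge> 1 \<Longrightarrow> bracket4 k \<ge> 5"
proof -
  show "bracket4 k \<ge> 1" for k by (induction k) (simp_all add: bracket4_Suc')
  then show "k \<ge> 1 \<Longrightarrow> bracket4 k \<ge> 5" by (cases k) (fastforce simp: bracket4_Suc')+
qed

lemma bracket4_mono: "k \<le> n \<Longrightarrow> bracket4 k \<le> bracket4 n"
  using card_mono[OF finite_PG PG_mono, of k n] by (simp add: card_PG)

lemma odd_bracket4: "odd (bracket4 n)"
  by (induction n) (simp_all add: bracket4_Suc')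

text \<open>By induction on the dimension; the four ranges of v are totals of the hyperplane, the
  value 3[n] - 1 missed there, weight 1 on all affine points or a complement, and at most one point
  of weight 0.\<close>

lemma total_weight_main:
  "v \<le> 3 * bracket4 n \<Longrightarrow> v \<noteq> 3 * bracket4 n - 1 \<Longrightarrow> v \<notin> exceptional \<Longrightarrow> total_weight n v"
proof (induction n arbitrary: v)
  case 0
  then have "v \<in> {0, 1, 3}" by auto
  then show ?case by (rule total_weight_0)
next
  case (Suc n)
  let ?b = "bracket4 n"
  have b: "?b \<ge> 1" by (rule bracket4_ge)
  have bS: "bracket4 (Suc n) = 4 * ?b + 1" by (rule bracket4_Suc')
  have pow: "4 ^ Suc n = 3 * ?b + 1" using three_bracket4[of n] by simp
  consider "v \<le> 3 * ?b" "v \<noteq> 3 * ?b - 1" | "v = 3 * ?b - 1" | "3 * ?b + 1 \<le> v" "v < 4 * ?b" | "4 * ?b \<le> v"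
    by linarith
  then show ?case
  proof cases
    case 1
    then show ?thesis using Suc total_weight_Suc by blast
  next
    case 2
    show ?thesis
    proof (cases "n = 0")
      case True
      then have "v = bracket4 0 + 1" using 2 by simp
      then have "v \<in> exceptional" by (intro exceptionalI[of 1 v 0]) simp_all
      then show ?thesis using Suc.prems by simp
    next
      case False
      then show ?thesis using total_weight_minus_2[of "Suc n"] pow 2 by simp
    qed
  next
    case 3
    define s where "s = v - 4 ^ Suc n"
    \<comment> \<open>Since s < [n] - 1, the excluded value 3[n] - 1 cannot occur for s; only an
      exceptional s blocks the induction hypothesis.\<close>
    have v: "v = 4 ^ Suc n + s" and s: "s + 1 < ?b" using 3 pow unfolding s_def by linarith+
    show ?thesis
    proof (cases "s \<in> exceptional")
      case False
      have "total_weight n s" by (rule Suc.IH) (use s False in auto)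
      then show ?thesis unfolding v by (rule total_weight_add_affine)
    next
      case True
      then obtain k d where kd: "s = bracket4 k + d" "d \<in> {1, 3, 9}" "s \<noteq> 4" "s \<noteq> 10"
        unfolding exceptional_def by blast
      have "k < n"
      proof (rule ccontr)
        assume "\<not> k < n"
        then have "?b \<le> bracket4 k" by (intro bracket4_mono) simp
        then show False using s kd(1) by linarith
      qed
      \<comment> \<open>For k = 0 the excluded values 4 and 10 leave only d = 1; for k > 0 the
        right-hand side is at least 16.\<close>
      have "d \<le> 4 ^ Suc k"
      proof (cases k)
        case 0
        then show ?thesis using kd by auto
      next
        case (Suc i)
        have "(1 :: nat) \<le> 4 ^ i" by simp
        then have "(16 :: nat) \<le> 4 ^ Suc k" unfolding Suc by simp
        then show ?thesis using kd(2) by auto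
      qed
      then have "total_weight (Suc n) (4 ^ Suc n + bracket4 k + d)"
        using \<open>k < n\<close> kd(2) by (intro total_weight_gap) auto
      then show ?thesis unfolding v kd(1) by (simp add: add.assoc)
    qed
  next
    case 4
    show ?thesis
    proof (cases "even v")
      case False
      then have "bracket4 (Suc n) \<le> v" using 4 unfolding bS by (cases "v = 4 * ?b") auto
      moreover have "even (v - bracket4 (Suc n))"
        using False odd_bracket4[of "Suc n"] by simp
      ultimately obtain u where "v = bracket4 (Suc n) + 2 * u"
        by (metis evenE le_add_diff_inverse)
      then show ?thesis using total_weight_odd[of u "Suc n"] Suc.prems(1) by simp
    next
      case True
      then have "even (v - 4 * ?b)" by simp
      then obtain u where u: "v = 4 * ?b + 2 * u" using 4 by (metis evenE le_add_diff_inverse)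
      have le3: "4 * ?b + 2 * u \<le> 12 * ?b + 3" "4 * ?b + 2 * u \<noteq> 12 * ?b + 2"
        using Suc.prems(1,2) unfolding u bS by simp_all
      have le: "u \<le> 4 * ?b"
      proof (rule ccontr)
        assume "\<not> u \<le> 4 * ?b"
        then have "u = 4 * ?b + 1" using le3(1) by linarith
        then show False using le3(2) by simp
      qed
      have "v \<noteq> bracket4 (Suc n) + d" if "d \<in> {1, 3, 9}" for d
      proof
        assume v: "v = bracket4 (Suc n) + d"
        have "v \<noteq> 4" using v b unfolding bS by linarith
        moreover have "v \<noteq> 10"
        proof
          assume "v = 10"
          then have "4 * ?b + 1 + d = 10" using v unfolding bS by simp
          \<comment> \<open>Of the offsets only d = 1 could give 10, with [n] = 2; but [n] is
            odd.\<close>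
          moreover have "?b \<noteq> 2" using odd_bracket4[of n] by auto
          ultimately show False using that b by (elim insertE emptyE; presburger)
        qed
        ultimately have "v \<in> exceptional" using exceptionalI[OF that v] by blast
        then show False using Suc.prems(3) by simp
      qed
      then have "v \<noteq> bracket4 (Suc n) + 1" "v \<noteq> bracket4 (Suc n) + 3" "v \<noteq> bracket4 (Suc n) + 9" by blast+
      \<comment> \<open>As v = [n+1] + (2u - 1), the offsets 1, 3, 9 are u = 1, 2, 5.\<close>
      then have "u \<notin> {1, 2, 5}" unfolding bS u by auto
      then show ?thesis unfolding u using le by (rule_tac total_weight_even)
    qed
  qed
qed

section \<open>Exceptional orders and the final assembly\<close>

text \<open>Fillings for the large groups on the heavy line, from weightings of a single line: 7 = 3
  + 4 * 1, and 10 = 3 * 3 + 1 with one point of weight 0.\<close>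

lemma PBD_7_10: "u \<in> {7, 10} \<Longrightarrow> \<exists>(X :: nat set) \<B>. is_PBD u {3, 4, 5} X \<B>"
proof -
  assume u: "u \<in> {7, 10}"
  have "total_weight 1 7" using total_weight_odd[of 1 1] by (simp add: bracket4_def)
  moreover have "total_weight 1 10" using total_weight_even[of 3 0] by simp
  ultimately have "has_PBD 63 u" using u total_weight_PBD by auto
  then show ?thesis unfolding has_PBD_def by blast
qed

text \<open>The total 4([n] - 5) + s is [n+1] + d exactly for s = 21 + d. The three equal parts of s
  come from Latin squares of order 7 or 10, a part 1 or 3 from extended parallel classes, and every
  part occurs as the fifth group beside four groups of size 4.\<close>

lemma exceptional_PBD:
  assumes "1 \<le> n" "d \<in> {1, 3, 9}"
  shows "has_PBD 94 (bracket4 (Suc n) + d)"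
proof -
  have b: "bracket4 n \<ge> 5" by (rule bracket4_ge(2)[OF assms(1)])
  have t0: "gdd_type [4, 4, 4, 4, 0]" "gdd_type [7, 7, 7, 1, 0]" "gdd_type [7, 7, 7, 3, 0]"
    "gdd_type [10, 10, 10, 0, 0]"
    using gdd_type_append_0[OF gdd_4_4_4_4] gdd_type_append_0[OF gdd_7_7_7_1]
      gdd_type_append_0[OF gdd_7_7_7_3] gdd_type_append_0[OF gdd_type_append_0[OF gdd_10_10_10]]
    by simp_all
  have u: "u \<le> 10 \<and> gdd_type [4, 4, 4, 4, u] \<and> (\<exists>(X :: nat set) \<B>. is_PBD u {3, 4, 5} X \<B>)"
    if u: "u \<in> {0, 1, 3, 7, 10}" for u
  proof (intro conjI)
    show "u \<le> 10" using u by auto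
    show "gdd_type [4, 4, 4, 4, u]"
      using u t0(1) gdd_4_4_4_4_1 gdd_4_4_4_4_3 gdd_4_4_4_4_7 gdd_4_4_4_4_10
      by (elim insertE emptyE) simp_all
    consider "u \<in> {0, 1, 3, 4}" | "u \<in> {7, 10}" using u by blast
    then show "\<exists>(X :: nat set) \<B>. is_PBD u {3, 4, 5} X \<B>"
      by cases (rule PBD_small PBD_7_10, assumption)+
  qed
  consider "d = 1" | "d = 3" | "d = 9" using assms(2) by blast
  then show ?thesis
  proof cases
    case 1
    have "has_PBD 94 (4 * (bracket4 n - 5) + sum_list [7, 7, 7, 1, 0])"
      by (rule heavy_line_PBD[OF assms(1) _ _ t0(2)]) (simp, simp, rule u, auto)
    moreover have "4 * (bracket4 n - 5) + sum_list [7, 7, 7, 1, 0] = bracket4 (Suc n) + d"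
      using b 1 by (simp add: bracket4_Suc')
    ultimately show ?thesis by simp
  next
    case 2
    have "has_PBD 94 (4 * (bracket4 n - 5) + sum_list [7, 7, 7, 3, 0])"
      by (rule heavy_line_PBD[OF assms(1) _ _ t0(3)]) (simp, simp, rule u, auto)
    moreover have "4 * (bracket4 n - 5) + sum_list [7, 7, 7, 3, 0] = bracket4 (Suc n) + d"
      using b 2 by (simp add: bracket4_Suc')
    ultimately show ?thesis by simp
  next
    case 3
    have "has_PBD 94 (4 * (bracket4 n - 5) + sum_list [10, 10, 10, 0, 0])"
      by (rule heavy_line_PBD[OF assms(1) _ _ t0(4)]) (simp, simp, rule u, auto)
    moreover have "4 * (bracket4 n - 5) + sum_list [10, 10, 10, 0, 0] = bracket4 (Suc n) + d"
      using b 3 by (simp add: bracket4_Suc')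
    ultimately show ?thesis by simp
  qed
qed

lemma bracket4_gt: "n < bracket4 n"
  by (induction n) (simp_all add: bracket4_Suc')

text \<open>The exceptional values with e < 3 are dealt with by hand: 2, 6, 8 are excluded, 14 is
  4^2 - 2, and 22, 24, 30 do not exceed 63.\<close>

lemma has_PBD_regular:
  assumes "v > 0" "v \<notin> {2, 6, 8}" "\<And>e d. 3 \<le> e \<Longrightarrow> d \<in> {1, 3, 9} \<Longrightarrow> v \<noteq> bracket4 e + d"
  shows "has_PBD 63 v"
proof (cases "v \<in> exceptional")
  case False
  \<comment> \<open>Any dimension with v < 3[n] - 1 will do; n = v + 1 suffices because n <
    [n].\<close>
  have "total_weight (Suc v) v"
    using bracket4_gt[of "Suc v"] False by (intro total_weight_main) linarith+
  then show ?thesis by (rule total_weight_PBD)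
next
  case True
  then obtain k d where kd: "v = bracket4 k + d" "d \<in> {1, 3, 9}" "v \<noteq> 4" "v \<noteq> 10"
    unfolding exceptional_def by blast
  have "k < 3" using assms(3)[of k d] kd by (meson not_less)
  then consider "k = 0" | "k = 1" | "k = 2" by linarith
  then show ?thesis
  proof cases
    case 1
    then show ?thesis using kd assms(2) by auto
  next
    case 2
    then have "v = 14" using kd assms(2) by (auto simp: bracket4_def)
    then show ?thesis using total_weight_PBD[OF total_weight_minus_2[of 2]] by simp
  next
    case 3
    then have v: "v = bracket4 (Suc 1) + d" using kd by (simp add: numeral_2_eq_2)
    have "has_PBD 94 v" unfolding v by (rule exceptional_PBD) (use kd in auto)
    then obtain X :: "nat set" and \<B> where "is_PBD v {3, 4, 5} X \<B>" unfolding has_PBD_def by blast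
    moreover have "v \<le> 63" using v kd(2) by (auto simp: bracket4_def)
    ultimately show ?thesis by (rule has_PBD_trivial_flats)
  qed
qed

theorem theorem1p4:
  fixes v :: nat
  assumes "v > 0" and "v \<notin> {2, 6, 8}"
  shows "if \<exists>e\<ge>3. int v - int (bracket4 e) \<in> {1, 3, 9}
         then \<exists>(X :: nat set) \<B>. is_PBD v {3, 4, 5} X \<B> \<and> three_point_flats_le 94 X \<B>
         else \<exists>(X :: nat set) \<B>. is_PBD v {3, 4, 5} X \<B> \<and> three_point_flats_le 63 X \<B>"
proof (cases "\<exists>e\<ge>3. int v - int (bracket4 e) \<in> {1, 3, 9}")
  case True
  then obtain e where e: "3 \<le> e" "int v - int (bracket4 e) \<in> {1, 3, 9}" by blast
  \<comment> \<open>The integer difference is positive, so truncated subtraction is exact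
    here.\<close>
  define d where "d = v - bracket4 e"
  have d: "v = bracket4 e + d" "d \<in> {1, 3, 9}" using e(2) unfolding d_def by auto
  obtain n where n: "e = Suc n" "1 \<le> n" using e(1) by (cases e) simp_all
  have "has_PBD 94 v" unfolding d(1) n(1) by (rule exceptional_PBD[OF n(2) d(2)])
  then show ?thesis unfolding if_P[OF True] has_PBD_def .
next
  case False
  have "v \<noteq> bracket4 e + d" if "3 \<le> e" "d \<in> {1, 3, 9}" for e d
    using False that by auto
  then have "has_PBD 63 v" using has_PBD_regular[OF assms] by blast
  then show ?thesis unfolding if_not_P[OF False] has_PBD_def .
qed

end
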